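(* Let $X$ be a Hilbert space with norm $\|\cdot\|$ and let $\mathcal J:X\to[0,\infty]$ be convex, lower semicontinuous, positively homogeneous of degree 1 (i.e. $\mathcal J(\lambda u)=\lambda\mathcal J(u)$ for all $\lambda>0$, $u\in X$), with dense domain $\{u\in X:\mathcal J(u)<\infty\}$. Let $w:[0,\infty)\to X$ be a solution of the gradient system $(X,\mathcal J,\frac12\|\cdot\|^2)$ with $\mathcal J(w(0))<\infty$. Define $S:[0,\infty)\to[0,\infty)$ by $$S(0)=0,\qquad S(t)=\min\{s\ge0 : \|w'_+(s)\|\le 1/t\}\quad\text{for } t>0,$$ and $u:[0,\infty)\to X$ by $u(t)=w(S(t))$. Then $u$ is an energetic solution for the energetic rate-independent system $(X,\mathcal E,\|\cdot\|)$ with $\mathcal E(t,u)=t\,\mathcal J(u)$.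
   Context: $E:X\to X^*$ is the Riesz isomorphism and $\partial\mathcal J(u)\subset X^*$ the convex subdifferential. Solution of the gradient system $(X,\mathcal J,\frac12\|\cdot\|^2)$: a function $w:[0,\infty)\to X$, continuous on $[0,\infty)$ and in $H^1_{\mathrm{loc}}((0,\infty);X)$, with $0\in Ew'(s)+\partial\mathcal J(w(s))$ for a.a. $s>0$. (For such $w$ it is classical that the right derivative $w'_+(s)=\lim_{h\to0^+}\frac1h(w(s+h)-w(s))$ exists for all $s>0$, is continuous from the right, that $s\mapsto\|w'_+(s)\|$ is non-increasing, and that $\|w'_+(s)\|\le\frac{\sqrt2}{s}\|w(0)\|$.) At $s=0$, $\|w'_+(0)\|$ is understood as $\lim_{s\to0^+}\|w'_+(s)\|\in[0,\infty]$. Convention: $0\cdot\infty=0$. Variation: $\mathrm{Var}_{\|\cdot\|}(u;[r,t])=\sup\{\sum_{j=1}^N\|u(t_j)-u(t_{j-1})\| : N\in\mathbb N,\ r\le t_0<t_1<\dots<t_N\le t\}$. Energetic solution: $u:[0,\infty)\to X$ is an energetic solution for $(X,\mathcal E,\|\cdot\|)$ with $\mathcal E(t,u)=t\mathcal J(u)$ if $t\mapsto\mathcal J(u(t))$ lies in $L^1_{\mathrm{loc}}([0,\infty))$ (in particular it is integrable near $0$) and, for all $r,t\ge0$ with $r<t$ in (E) and all $t\ge0$ in (S): (S) for all $\tilde u\in X$: $t\mathcal J(u(t))\le t\mathcal J(\tilde u)+\|\tilde u-u(t)\|$; (E) $t\mathcal J(u(t))+\mathrm{Var}_{\|\cdot\|}(u;[r,t])=r\mathcal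 J(u(r))+\int_r^t\mathcal J(u(\tau))\,d\tau$; (I) $u(0)=u(0^+):=\lim_{\tau\to0^+}u(\tau)$ in the norm topology. *)

theory Defs
  imports "HOL-Analysis.Analysis"
begin

text \<open>A Hilbert space, not necessarily separable, is a type of sort
  \<open>{real_inner, complete_space}\<close>, its dual \<open>X\<^sup>*\<close> is the type \<open>'a \<Rightarrow>\<^sub>L real\<close>, and the Riesz
  isomorphism \<open>E\<close> is \<^const>\<open>blinfun_inner_right\<close>, that is \<open>E v = (\<lambda>y. v \<bullet> y)\<close>.
  A functional with values in \<open>[0,\<infinity>]\<close> has type \<open>'a \<Rightarrow> ennreal\<close>; in \<^typ>\<open>ennreal\<close> one has
  \<open>0 * \<infinity> = 0\<close>.\<close>

definition convex_functional :: "('a::real_vector \<Rightarrow> ennreal) \<Rightarrow> bool" where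
  "convex_functional J \<longleftrightarrow>
     (\<forall>x y. \<forall>\<theta>::real. 0 \<le> \<theta> \<and> \<theta> \<le> 1 \<longrightarrow>
        J ((1 - \<theta>) *\<^sub>R x + \<theta> *\<^sub>R y) \<le> ennreal (1 - \<theta>) * J x + ennreal \<theta> * J y)"

definition lower_semicontinuous :: "('a::topological_space \<Rightarrow> ennreal) \<Rightarrow> bool" where
  "lower_semicontinuous J \<longleftrightarrow> (\<forall>x. J x \<le> Liminf (at x) J)"

definition positively_homogeneous :: "('a::real_vector \<Rightarrow> ennreal) \<Rightarrow> bool" where
  "positively_homogeneous J \<longleftrightarrow> (\<forall>(r::real) x. 0 < r \<longrightarrow> J (r *\<^sub>R x) = ennreal r * J x)"

definition subdifferential ::
    "('a::real_normed_vector \<Rightarrow> ennreal) \<Rightarrow> 'a \<Rightarrow> ('a \<Rightarrow>\<^sub>L real) set" where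
  "subdifferential J x =
     {\<xi>. J x < \<infinity> \<and>
         (\<forall>y. enn2ereal (J x) + ereal (blinfun_apply \<xi> (y - x)) \<le> enn2ereal (J y))}"

text \<open>The continuous function \<open>w\<close> belongs to \<open>H\<^sup>1\<^sub>l\<^sub>o\<^sub>c((0,\<infinity>);X)\<close> with weak derivative \<open>g\<close>, in the
  usual one-dimensional sense: \<open>g\<close> is in \<open>L\<^sup>2\<^sub>l\<^sub>o\<^sub>c((0,\<infinity>);X)\<close> and \<open>w\<close> is a primitive of it.
  The library's Bochner integral needs a second countable target space. Here
  \<^const>\<open>measurable_on\<close>, being an almost everywhere limit of continuous functions, is
  strong (Bochner) measurability, and for a strongly measurable function with integrable norm
  the gauge integral \<^const>\<open>has_integral\<close> is the Bochner integral.\<close>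

definition H1_loc_with_derivative ::
    "(real \<Rightarrow> 'a::real_normed_vector) \<Rightarrow> (real \<Rightarrow> 'a) \<Rightarrow> bool" where
  "H1_loc_with_derivative w g \<longleftrightarrow>
     g measurable_on {0<..} \<and>
     (\<forall>a b. 0 < a \<and> a < b \<longrightarrow>
        set_integrable lebesgue {a..b} (\<lambda>s. (norm (g s))\<^sup>2) \<and>
        (g has_integral (w b - w a)) {a..b})"

text \<open>Functions on \<open>[0,\<infinity>)\<close> are total functions on \<^typ>\<open>real\<close> whose values at negative
  arguments play no role.\<close>

definition gradient_solution ::
    "('a::{real_inner,complete_space} \<Rightarrow> ennreal) \<Rightarrow> (real \<Rightarrow> 'a) \<Rightarrow> bool" where
  "gradient_solution J w \<longleftrightarrow>
     continuous_on {0..} w \<and>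
     (\<exists>w'. H1_loc_with_derivative w w' \<and>
        (AE s in lebesgue. 0 < s \<longrightarrow>
           0 \<in> (\<lambda>\<xi>. blinfun_inner_right (w' s) + \<xi>) ` subdifferential J (w s)))"

definition right_deriv :: "(real \<Rightarrow> 'a::real_normed_vector) \<Rightarrow> real \<Rightarrow> 'a" where
  "right_deriv w s = Lim (at_right 0) (\<lambda>h. (1 / h) *\<^sub>R (w (s + h) - w s))"

text \<open>The norm of the right derivative, read at \<open>s = 0\<close> as its limit in \<open>[0,\<infinity>]\<close> as
  \<open>s\<close> decreases to \<open>0\<close>.\<close>

definition right_speed :: "(real \<Rightarrow> 'a::real_normed_vector) \<Rightarrow> real \<Rightarrow> ennreal" where
  "right_speed w s =
     (if s = 0 then Lim (at_right 0) (\<lambda>\<sigma>. ennreal (norm (right_deriv w \<sigma>)))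
      else ennreal (norm (right_deriv w s)))"

definition variation ::
    "(real \<Rightarrow> 'a::real_normed_vector) \<Rightarrow> real \<Rightarrow> real \<Rightarrow> ennreal" where
  "variation u r t =
     Sup {ennreal (\<Sum>j = 1..N. norm (u (\<tau> j) - u (\<tau> (j - 1)))) | (N::nat) (\<tau>::nat \<Rightarrow> real).
            r \<le> \<tau> 0 \<and> strict_mono_on {0..N} \<tau> \<and> \<tau> N \<le> t}"

text \<open>Energetic solutions for the energy \<open>(t, v) \<mapsto> t * J v\<close> and the dissipation distance given
  by the norm; stability and energy balance are (in)equalities in \<open>[0,\<infinity>]\<close>.\<close>

definition energetic_solution ::
    "('a::{real_inner,complete_space} \<Rightarrow> ennreal) \<Rightarrow> (real \<Rightarrow> 'a) \<Rightarrow> bool" where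
  "energetic_solution J u \<longleftrightarrow>
     (\<forall>T>0. (\<lambda>t. J (u t)) \<in> borel_measurable (lebesgue_on {0..T}) \<and>
            (\<integral>\<^sup>+ t. J (u t) \<partial>lebesgue_on {0..T}) < \<infinity>) \<and>
     (\<forall>t\<ge>0. \<forall>v. ennreal t * J (u t) \<le> ennreal t * J v + ennreal (norm (v - u t))) \<and>
     (\<forall>r t. 0 \<le> r \<and> r < t \<longrightarrow>
        ennreal t * J (u t) + variation u r t =
        ennreal r * J (u r) + (\<integral>\<^sup>+ \<tau>. J (u \<tau>) \<partial>lebesgue_on {r..t})) \<and>
     (u \<longlongrightarrow> u 0) (at_right 0)"

end

theory Submission
  imports Defs
begin

text \<open>
  A gradient curve \<open>w\<close> descends \<open>J\<close> as steeply as possible: \<open>- w'\<^sub>+(s)\<close> is a subgradient of \<open>J\<close> at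
  \<open>w(s)\<close>, and \<open>J(w)\<close> falls at the rate \<open>\<parallel>w'\<^sub>+\<parallel>\<^sup>2\<close>. The curve \<open>u = w \<circ> S\<close> visits points of \<open>w\<close>, and the
  clock \<open>S\<close> is chosen so that two bounds hold.

  \<^item> At time \<open>p\<close> the speed at \<open>S(p)\<close> is at most \<open>1/p\<close>, so there is a subgradient of norm at most \<open>1/p\<close>
    at \<open>u(p)\<close>. This is the global stability (S). Tested with \<open>u(q)\<close> it gives
    \<open>p * (J(u(p)) - J(u(q))) \<le> \<parallel>u(q) - u(p)\<parallel>\<close>.
  \<^item> By minimality of \<open>S(q)\<close> the speed exceeds \<open>1/q\<close> on the piece of \<open>w\<close> between \<open>S(p)\<close> and \<open>S(q)\<close>. The
    energy therefore falls there at a rate of at least \<open>\<parallel>w'\<^sub>+\<parallel> / q\<close>, that is,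
    \<open>\<parallel>u(q) - u(p)\<parallel> \<le> q * (J(u(p)) - J(u(q)))\<close>.

  On a partition of mesh tending to \<open>0\<close> the factors \<open>p\<close> and \<open>q\<close> at the two ends of an interval agree up
  to the mesh, while the decrements of the monotone function \<open>J(u)\<close> have a bounded sum. The two
  bounds are thus squeezed together into the energy balance (E). Jumps of \<open>S\<close>, across which \<open>u\<close>
  leaves out a piece of \<open>w\<close>, need no separate treatment. This is lemma \<open>energy_balance\<close>.

  The facts about \<open>w\<close> are obtained without differentiating \<open>w\<close> almost everywhere. The differential
  inclusion is used in two integrated forms: the evolution variational inequality
  (\<open>gradient_solution_evi\<close>) and the contraction property (\<open>gradient_solution_contraction\<close>). By
  contraction, the increments of \<open>w\<close> over steps of a given length decrease along the curve, so the
  speed at \<open>s\<close> can be read as the least Lipschitz constant of \<open>w\<close> on \<open>[s,\<infinity>)\<close>. This quantity is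
  antitone and continuous from the right for trivial reasons, and \<open>right_speed_le_iff\<close> identifies it
  with the norm of the right derivative. The stability bound is \<open>energy_stable\<close>, the dissipation bound
  is \<open>energy_dissipation\<close>; both are stated for Lipschitz constants.
\<close>

section \<open>Increments and suprema on an interval\<close>

text \<open>Summing over a uniform partition makes the errors on the right telescope. The lemma replaces the
  sentence ``a function with nonpositive derivative is antitone'' where no derivative is at hand;
  \<open>G\<close> measures the interval against which the error is small.\<close>

lemma le_if_fine_increments_small:
  fixes \<phi> G :: "real \<Rightarrow> real"
  assumes "a \<le> b"
    and incr: "\<And>\<epsilon>. 0 < \<epsilon> \<Longrightarrow> \<exists>\<delta>>0. \<forall>p q. a \<le> p \<and> p < q \<and> q \<le> b \<and> q - p \<le> \<delta> \<longrightarrow>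
                   \<phi> q - \<phi> p \<le> \<epsilon> * (G q - G p)"
  shows "\<phi> b \<le> \<phi> a"
proof (cases "a = b")
  case False
  then have ab: "a < b" using assms(1) by simp
  have bound: "\<phi> b - \<phi> a \<le> \<epsilon> * (G b - G a)" if \<epsilon>: "0 < \<epsilon>" for \<epsilon>
  proof -
    obtain \<delta> where \<delta>: "\<delta> > 0" "\<And>p q. a \<le> p \<Longrightarrow> p < q \<Longrightarrow> q \<le> b \<Longrightarrow> q - p \<le> \<delta> \<Longrightarrow>
                   \<phi> q - \<phi> p \<le> \<epsilon> * (G q - G p)"
      using incr[OF \<epsilon>] by blast
    obtain n :: nat where n: "(b - a) / \<delta> < n" using reals_Archimedean2 by blast
    define d where "d = (b - a) / n"
    have n0: "0 < real n" using n ab \<delta>(1) by (smt (verit) divide_nonneg_pos)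
    have d: "0 < d" "d \<le> \<delta>" "a + real n * d = b"
      using n n0 ab \<delta>(1) by (auto simp: d_def field_simps)
    have "j \<le> n \<Longrightarrow> \<phi> (a + real j * d) - \<phi> a \<le> \<epsilon> * (G (a + real j * d) - G a)" for j
    proof (induction j)
      case (Suc j)
      have "real (Suc j) * d \<le> real n * d" using Suc.prems d(1) by (intro mult_right_mono) auto
      then have "\<phi> (a + real (Suc j) * d) - \<phi> (a + real j * d)
          \<le> \<epsilon> * (G (a + real (Suc j) * d) - G (a + real j * d))"
        using d by (intro \<delta>(2)) (auto simp: algebra_simps)
      then show ?case using Suc by (simp add: algebra_simps)
    qed simp
    from this[of n] d(3) show ?thesis by simp
  qed
  have "\<phi> b - \<phi> a \<le> 0"
  proof (cases "G b - G a \<le> 0")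
    case True then show ?thesis using bound[of 1] by simp
  next
    case False
    show ?thesis
    proof (rule field_le_epsilon)
      fix e :: real assume "e > 0"
      then show "\<phi> b - \<phi> a \<le> 0 + e" using bound[of "e / (G b - G a)"] False by simp
    qed
  qed
  then show ?thesis by simp
qed simp

text \<open>Real induction: the last point of the closed set at which \<open>P\<close> holds can only be \<open>b\<close>.\<close>

lemma closed_property_reaches_right_end:
  fixes a b :: real
  assumes "a \<le> b" and "P a" and cl: "closed {s \<in> {a..b}. P s}"
    and step: "\<And>s. a \<le> s \<Longrightarrow> s < b \<Longrightarrow> P s \<Longrightarrow> \<exists>s'. s < s' \<and> s' \<le> b \<and> P s'"
  shows "P b"
proof -
  have "compact {s \<in> {a..b}. P s}"
    using cl by (metis (no_types, lifting) compact_Icc compact_Int_closed inf.absorb_iff2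
        mem_Collect_eq subsetI)
  moreover have "a \<in> {s \<in> {a..b}. P s}" using assms by auto
  ultimately obtain m where m: "m \<in> {s \<in> {a..b}. P s}" "\<And>t. t \<in> {s \<in> {a..b}. P s} \<Longrightarrow> t \<le> m"
    using compact_attains_sup[of "{s \<in> {a..b}. P s}"] by blast
  have "m = b"
  proof (rule ccontr)
    assume "m \<noteq> b"
    then obtain s' where "m < s'" "s' \<le> b" "P s'" using step[of m] m(1) by auto
    then show False using m(1) m(2)[of s'] by auto
  qed
  then show ?thesis using m by simp
qed

section \<open>Least Lipschitz constants\<close>

lemma least_lipschitz_constant:
  assumes "C-lipschitz_on A f"
  obtains L where "L-lipschitz_on A f" and "\<And>c. c-lipschitz_on A f \<Longrightarrow> L \<le> c"
proof
  let ?K = "{c. c-lipschitz_on A f}"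
  have bdd: "bdd_below ?K" by (auto intro!: bdd_belowI[of _ 0] lipschitz_on_nonneg)
  show "Inf ?K \<le> c" if "c-lipschitz_on A f" for c
    using that by (intro cInf_lower bdd) auto
  show "(Inf ?K)-lipschitz_on A f"
  proof (rule lipschitz_onI)
    show "0 \<le> Inf ?K" using assms by (intro cInf_greatest) (auto intro: lipschitz_on_nonneg)
    fix x y assume xy: "x \<in> A" "y \<in> A"
    show "dist (f x) (f y) \<le> Inf ?K * dist x y"
    proof (cases "dist x y = 0")
      case False
      then have "dist (f x) (f y) / dist x y \<le> Inf ?K"
        using assms xy False
        by (intro cInf_greatest) (auto simp: divide_le_eq intro: lipschitz_onD)
      then show ?thesis using False by (simp add: divide_le_eq)
    qed simp
  qed
qed

lemma lipschitz_on_limit_constant: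
  fixes c :: real
  assumes "0 \<le> c" "\<And>c'. c < c' \<Longrightarrow> c'-lipschitz_on A f"
  shows "c-lipschitz_on A f"
proof -
  have "(c + 1)-lipschitz_on A f" using assms by simp
  then obtain L where L: "L-lipschitz_on A f" "\<And>c. c-lipschitz_on A f \<Longrightarrow> L \<le> c"
    by (rule least_lipschitz_constant) blast
  have "L \<le> c" using L(2) assms(2) by (metis dense not_le)
  then show ?thesis using L(1) lipschitz_on_le by blast
qed

section \<open>Lower semicontinuity\<close>

lemma lower_semicontinuous_le_limit:
  fixes J :: "'a::topological_space \<Rightarrow> ennreal"
  assumes lsc: "lower_semicontinuous J" and F: "F \<noteq> bot"
    and x: "(x \<longlongrightarrow> l) F" and c: "(c \<longlongrightarrow> d) F"
    and le: "\<forall>\<^sub>F i in F. J (x i) \<le> ennreal (c i)"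
  shows "J l \<le> ennreal d"
proof (rule ccontr)
  assume "\<not> J l \<le> ennreal d"
  then obtain y where y: "ennreal d < y" "y < J l" using dense not_le by metis
  have "\<forall>\<^sub>F v in at l. y < J v"
    using lsc y(2) unfolding lower_semicontinuous_def le_Liminf_iff by blast
  then have "\<forall>\<^sub>F v in nhds l. y < J v"
    using y(2) by (auto simp: eventually_at_filter elim: eventually_mono)
  then have "\<forall>\<^sub>F i in F. y < J (x i)"
    using x unfolding filterlim_iff by blast
  moreover have "\<forall>\<^sub>F i in F. ennreal (c i) < y"
    using tendsto_ennrealI[OF c] y(1) by (rule order_tendstoD)
  ultimately have "\<forall>\<^sub>F i in F. False"
    using le by eventually_elim auto
  then show False using F by simp
qed

lemma closed_sublevel_along_curve:
  fixes J :: "'a::topological_space \<Rightarrow> ennreal" and w :: "real \<Rightarrow> 'a"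
  assumes "lower_semicontinuous J" "continuous_on {a..b} w" "continuous_on {a..b} c"
  shows "closed {s \<in> {a..b}. J (w s) \<le> ennreal (c s)}"
  unfolding closed_sequential_limits
proof (intro allI impI, elim conjE)
  fix x l assume x: "\<forall>n. x n \<in> {s \<in> {a..b}. J (w s) \<le> ennreal (c s)}" "x \<longlonglongrightarrow> l"
  have l: "l \<in> {a..b}" using closed_sequentially[OF closed_atLeastAtMost, of x a b l] x by auto
  then have "J (w l) \<le> ennreal (c l)"
    using x continuous_on_tendsto_compose[OF assms(2) x(2)] continuous_on_tendsto_compose[OF assms(3) x(2)]
    by (intro lower_semicontinuous_le_limit[OF assms(1), of sequentially "\<lambda>n. w (x n)" _ "\<lambda>n. c (x n)"])
       auto
  then show "l \<in> {s \<in> {a..b}. J (w s) \<le> ennreal (c s)}" using l by simp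
qed

section \<open>The differential inclusion in integrated form\<close>

text \<open>An integrated product rule for \<open>\<parallel>z - y\<parallel>\<^sup>2 / 2\<close>. Over \<open>[p,q]\<close> its increment is exactly the inner product
  of the midpoint of \<open>z(p) - y\<close> and \<open>z(q) - y\<close> with the integral of \<open>f\<close>. On short intervals the
  midpoint is uniformly close to \<open>z(s) - y\<close>, at a cost of a small multiple of the integral of \<open>G\<close>.
  Testing with a fixed vector before integrating keeps all integrals real-valued.\<close>

lemma half_norm_increment_le:
  fixes z f :: "real \<Rightarrow> 'a::real_inner" and G :: "real \<Rightarrow> real"
  assumes ab: "a \<le> b" and cont: "continuous_on {a..b} z"
    and f: "\<And>p q. a \<le> p \<Longrightarrow> p < q \<Longrightarrow> q \<le> b \<Longrightarrow> (f has_integral z q - z p) {p..q}"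
    and G: "G integrable_on {a..b}" and fG: "\<And>s. norm (f s) \<le> G s"
    and N: "negligible N" and k: "\<And>s. a < s \<Longrightarrow> s < b \<Longrightarrow> s \<notin> N \<Longrightarrow> (z s - y) \<bullet> f s \<le> k"
  shows "(norm (z b - y))\<^sup>2 / 2 - (norm (z a - y))\<^sup>2 / 2 \<le> k * (b - a)"
proof -
  define \<phi> where "\<phi> s = (norm (z s - y))\<^sup>2 / 2 - k * s" for s
  define \<Gamma> where "\<Gamma> s = integral {a..s} G" for s
  have "\<phi> b \<le> \<phi> a"
  proof (rule le_if_fine_increments_small[OF ab, where G = \<Gamma>])
    fix \<epsilon> :: real assume \<epsilon>: "0 < \<epsilon>"
    have "uniformly_continuous_on {a..b} z" using cont compact_uniformly_continuous by blast
    then obtain \<delta> where \<delta>: "\<delta> > 0"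
      "\<And>s s'. s \<in> {a..b} \<Longrightarrow> s' \<in> {a..b} \<Longrightarrow> dist s' s < \<delta> \<Longrightarrow> dist (z s') (z s) < \<epsilon>"
      unfolding uniformly_continuous_on_def using \<epsilon> by metis
    have "\<phi> q - \<phi> p \<le> \<epsilon> * (\<Gamma> q - \<Gamma> p)" if pq: "a \<le> p" "p < q" "q \<le> b" "q - p \<le> \<delta> / 2" for p q
    proof -
      define m where "m = (1/2) *\<^sub>R (z p + z q)"
      \<comment> \<open>The exceptional set, and the end points, are overwritten by the upper bound.\<close>
      define h where "h s = (if s \<in> N \<union> {a,b} then k + \<epsilon> * G s else (m - y) \<bullet> f s)" for s
      have "(((\<bullet>) (m - y) \<circ> f) has_integral (m - y) \<bullet> (z q - z p)) {p..q}"
        by (rule has_integral_linear[OF f[OF pq(1-3)] bounded_linear_inner_right])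
      then have 1: "(h has_integral (m - y) \<bullet> (z q - z p)) {p..q}"
        by (rule has_integral_spike[rotated 2, where S="N \<union> {a,b}"]) (use N in \<open>auto simp: h_def\<close>)
      have "(G has_integral integral {p..q} G) {p..q}"
        using pq by (intro integrable_integral integrable_on_subinterval[OF G]) auto
      moreover have "integral {p..q} G = \<Gamma> q - \<Gamma> p"
        unfolding \<Gamma>_def using pq
          Henstock_Kurzweil_Integration.integral_combine[of a p q G] integrable_on_subinterval[OF G]
        by (smt (verit) atLeastatMost_subset_iff)
      ultimately have 2: "((\<lambda>s. k + \<epsilon> * G s) has_integral k * (q - p) + \<epsilon> * (\<Gamma> q - \<Gamma> p)) {p..q}"
        using has_integral_const_real[of k p q] pq
        by (intro has_integral_add has_integral_mult_right) (auto simp: mult.commute)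
      have "h s \<le> k + \<epsilon> * G s" if s: "s \<in> {p..q}" for s
      proof (cases "s \<in> N \<union> {a,b}")
        case False
        have "dist (z p) (z s) < \<epsilon>" "dist (z q) (z s) < \<epsilon>"
          using s pq \<delta>(1) by (auto intro!: \<delta>(2) simp: dist_real_def)
        moreover have "m - z s = (1/2) *\<^sub>R ((z p - z s) + (z q - z s))"
          by (simp add: m_def algebra_simps flip: scaleR_2)
        ultimately have "norm (m - z s) \<le> \<epsilon>"
          using norm_triangle_ineq[of "z p - z s" "z q - z s"] by (simp add: dist_norm)
        then have "(m - z s) \<bullet> f s \<le> \<epsilon> * G s"
          using norm_cauchy_schwarz[of "m - z s" "f s"] fG[of s] \<epsilon>
          by (smt (verit) mult_mono norm_ge_zero)
        moreover have "(z s - y) \<bullet> f s \<le> k" using False s pq by (intro k) auto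
        ultimately show ?thesis using False by (simp add: h_def inner_diff_left)
      qed (simp add: h_def)
      from has_integral_le[OF 1 2 this]
      have "(m - y) \<bullet> (z q - z p) \<le> k * (q - p) + \<epsilon> * (\<Gamma> q - \<Gamma> p)" .
      moreover have "(m - y) \<bullet> (z q - z p) = (norm (z q - y))\<^sup>2 / 2 - (norm (z p - y))\<^sup>2 / 2"
      proof -
        have half: "2 *\<^sub>R (m - y) = (z q - y) + (z p - y)" by (simp add: m_def scaleR_2 algebra_simps)
        have difference_of_squares: "(P + Q) \<bullet> (P - Q) = (norm P)\<^sup>2 - (norm Q)\<^sup>2" for P Q :: 'a
          by (simp add: power2_norm_eq_inner inner_add_left inner_diff_right inner_commute[of Q P])
        from half have "2 * ((m - y) \<bullet> (z q - z p)) = ((z q - y) + (z p - y)) \<bullet> ((z q - y) - (z p - y))"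
          by (metis inner_scaleR_left add_diff_cancel_right diff_add_cancel diff_diff_eq2)
        also have "\<dots> = (norm (z q - y))\<^sup>2 - (norm (z p - y))\<^sup>2"
          by (rule difference_of_squares)
        finally show ?thesis by simp
      qed
      ultimately show ?thesis by (simp add: \<phi>_def algebra_simps)
    qed
    then show "\<exists>\<delta>>0. \<forall>p q. a \<le> p \<and> p < q \<and> q \<le> b \<and> q - p \<le> \<delta> \<longrightarrow> \<phi> q - \<phi> p \<le> \<epsilon> * (\<Gamma> q - \<Gamma> p)"
      using \<delta>(1) by (intro exI[of _ "\<delta>/2"]) auto
  qed
  then show ?thesis by (simp add: \<phi>_def algebra_simps)
qed

text \<open>The inclusion \<open>0 \<in> E w'(s) + \<partial>J(w(s))\<close>, spelled out in real numbers.\<close>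

lemma gradient_solution_ae_subgradient:
  assumes "gradient_solution J w"
  obtains g N where "H1_loc_with_derivative w g" and "negligible N"
    and "\<And>s. 0 < s \<Longrightarrow> s \<notin> N \<Longrightarrow> J (w s) < \<infinity>"
    and "\<And>s y. 0 < s \<Longrightarrow> s \<notin> N \<Longrightarrow> J y < \<infinity> \<Longrightarrow>
           enn2real (J (w s)) + g s \<bullet> (w s - y) \<le> enn2real (J y)"
proof -
  obtain g where g: "H1_loc_with_derivative w g"
    and ae: "AE s in lebesgue. 0 < s \<longrightarrow>
        0 \<in> (\<lambda>\<xi>. blinfun_inner_right (g s) + \<xi>) ` subdifferential J (w s)"
    using assms unfolding gradient_solution_def by blast
  obtain N where N: "N \<in> null_sets lebesgue" "\<And>s. s \<notin> N \<Longrightarrow> 0 < s \<Longrightarrow>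
        0 \<in> (\<lambda>\<xi>. blinfun_inner_right (g s) + \<xi>) ` subdifferential J (w s)"
    using ae unfolding eventually_ae_filter by auto
  have sub: "J (w s) < \<infinity>"
    "J y < \<infinity> \<Longrightarrow> enn2real (J (w s)) + g s \<bullet> (w s - y) \<le> enn2real (J y)"
    if s: "0 < s" "s \<notin> N" for s y
  proof -
    obtain \<xi> where \<xi>: "\<xi> \<in> subdifferential J (w s)" "0 = blinfun_inner_right (g s) + \<xi>"
      using N(2)[OF s(2,1)] by blast
    have "\<xi> = - blinfun_inner_right (g s)" using \<xi>(2) by (simp add: eq_neg_iff_add_eq_0 add.commute)
    then have \<xi>_apply: "blinfun_apply \<xi> (y - w s) = g s \<bullet> (w s - y)"
      by (simp add: blinfun.minus_left inner_diff_right)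
    show fin: "J (w s) < \<infinity>" using \<xi>(1) by (simp add: subdifferential_def)
    show "enn2real (J (w s)) + g s \<bullet> (w s - y) \<le> enn2real (J y)" if "J y < \<infinity>"
    proof -
      have "enn2ereal (J (w s)) + ereal (g s \<bullet> (w s - y)) \<le> enn2ereal (J y)"
        using \<xi>(1) \<xi>_apply unfolding subdifferential_def by (smt (verit) mem_Collect_eq)
      moreover have "enn2ereal (J v) = ereal (enn2real (J v))" if "J v < \<infinity>" for v
        using that by (cases "J v") (auto simp: enn2ereal_ennreal)
      ultimately show ?thesis using fin \<open>J y < \<infinity>\<close> by simp
    qed
  qed
  show thesis by (rule that[OF g _ sub]) (use N(1) in \<open>auto simp: negligible_iff_null_sets\<close>)
qed

lemma H1_loc_dominated:
  assumes "H1_loc_with_derivative w g" "0 < a" "a \<le> b"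
  shows "(\<lambda>s. 1 + (norm (g s))\<^sup>2) integrable_on {a..b}"
proof (cases "a = b")
  case False
  then have "set_integrable lebesgue {a..b} (\<lambda>s. (norm (g s))\<^sup>2)"
    using assms unfolding H1_loc_with_derivative_def by auto
  then have "(\<lambda>s. (norm (g s))\<^sup>2) integrable_on {a..b}"
    by (rule set_lebesgue_integral_eq_integral)
  then show ?thesis by (intro integrable_add) auto
qed (use integrable_on_refl[of _ b] in auto)

text \<open>Thus the majorant \<open>1 + \<parallel>g\<parallel>\<^sup>2\<close>, integrable by the \<open>H\<^sup>1\<close> property, dominates \<open>\<parallel>g\<parallel>\<close>.\<close>

lemma norm_le_one_plus_square: "norm v \<le> 1 + (norm v)\<^sup>2"
  using zero_le_power2[of "norm v - 1/2"] by (simp add: power2_eq_square algebra_simps)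

text \<open>If the energy stayed above its value at \<open>s\<close> on an interval to the right of \<open>s\<close>, the subgradient
  inequality with test point \<open>w(s)\<close> would make the distance to \<open>w(s)\<close> nonincreasing there. Then \<open>w\<close>
  would be constant, and so would the energy. Hence every sublevel set can be prolonged to the right,
  and lower semicontinuity makes it closed.\<close>

lemma gradient_solution_energy_antimono:
  assumes lsc: "lower_semicontinuous J" and w: "gradient_solution J w" and ab: "0 < a" "a \<le> b"
  shows "J (w b) \<le> J (w a)"
proof (cases "J (w a) = \<infinity>")
  case False
  then obtain E where E: "J (w a) = ennreal E" "0 \<le> E" by (cases "J (w a)") auto
  obtain g N where g: "H1_loc_with_derivative w g" and N: "negligible N"
    and fin: "\<And>s. 0 < s \<Longrightarrow> s \<notin> N \<Longrightarrow> J (w s) < \<infinity>"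
    and sub: "\<And>s y. 0 < s \<Longrightarrow> s \<notin> N \<Longrightarrow> J y < \<infinity> \<Longrightarrow>
           enn2real (J (w s)) + g s \<bullet> (w s - y) \<le> enn2real (J y)"
    by (rule gradient_solution_ae_subgradient[OF w]) blast
  have cont: "continuous_on {0..} w" using w unfolding gradient_solution_def by blast
  have "J (w b) \<le> ennreal E"
  proof (rule closed_property_reaches_right_end[OF ab(2), where P = "\<lambda>s. J (w s) \<le> ennreal E"])
    show "closed {s \<in> {a..b}. J (w s) \<le> ennreal E}"
      by (intro closed_sublevel_along_curve lsc continuous_on_const continuous_on_subset[OF cont])
         (use ab in auto)
    fix s assume s: "a \<le> s" "s < b" "J (w s) \<le> ennreal E"
    show "\<exists>s'. s < s' \<and> s' \<le> b \<and> J (w s') \<le> ennreal E"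
    proof (rule ccontr)
      assume "\<not> ?thesis"
      then have above: "J (w r) > ennreal E" if "s < r" "r \<le> b" for r using that not_le by blast
      have s_fin: "J (w s) < \<infinity>" using s(3) by (metis ennreal_less_top infinity_ennreal_def le_less_trans)
      have "(norm (w b - w s))\<^sup>2 / 2 - (norm (w s - w s))\<^sup>2 / 2 \<le> 0 * (b - s)"
      proof (rule half_norm_increment_le[OF _ _ _ H1_loc_dominated[OF g] norm_le_one_plus_square N])
        show "(w r - w s) \<bullet> g r \<le> 0" if r: "s < r" "r < b" "r \<notin> N" for r
        proof -
          have "J (w s) \<le> J (w r)" using s(3) above[of r] r by auto
          then have "enn2real (J (w s)) \<le> enn2real (J (w r))"
            using fin[of r] r s ab by (intro enn2real_mono) auto
          then show ?thesis using sub[OF _ r(3) s_fin] r s ab by (simp add: inner_commute)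
        qed
      qed (use s ab g in \<open>auto simp: H1_loc_with_derivative_def intro: continuous_on_subset[OF cont]\<close>)
      then have "w b = w s" by simp
      then show False using above[of b] s by auto
    qed
  qed (use E in auto)
  then show ?thesis using E by simp
qed simp

text \<open>The subdifferential is empty where \<open>J\<close> is infinite, so the energy is finite at almost every
  time before \<open>s\<close>.\<close>

lemma gradient_solution_finite_energy:
  assumes lsc: "lower_semicontinuous J" and w: "gradient_solution J w" and s: "0 < s"
  shows "J (w s) < \<infinity>"
proof -
  obtain g N where N: "negligible N" and fin: "\<And>s. 0 < s \<Longrightarrow> s \<notin> N \<Longrightarrow> J (w s) < \<infinity>"
    by (rule gradient_solution_ae_subgradient[OF w]) blast
  have "\<not> {0<..<s} \<subseteq> N"
    using N s negligible_subset by (metis open_greaterThanLessThan open_not_negligible greaterThanLessThan_empty_iff not_le)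
  then obtain r where "r \<in> {0<..<s}" "r \<notin> N" by blast
  then have "0 < r" "r < s" "r \<notin> N" by auto
  then show ?thesis using fin[of r] gradient_solution_energy_antimono[OF lsc w, of r s] by auto
qed

text \<open>The evolution variational inequality. The subgradient inequality bounds \<open>(w(s) - y) \<bullet> w'(s)\<close> by
  \<open>J(y) - J(w(s))\<close>, and monotonicity of the energy replaces \<open>J(w(s))\<close> by the smaller value at the right
  end, so that no integral of the energy appears. The case \<open>p = 0\<close> is reached by continuity of \<open>w\<close>.\<close>

lemma gradient_solution_evi:
  assumes lsc: "lower_semicontinuous J" and w: "gradient_solution J w"
    and pq: "0 \<le> p" "p < q" and y: "J y < \<infinity>"
  shows "(norm (w q - y))\<^sup>2 / 2 - (norm (w p - y))\<^sup>2 / 2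
           \<le> (q - p) * (enn2real (J y) - enn2real (J (w q)))"
proof -
  obtain g N where g: "H1_loc_with_derivative w g" and N: "negligible N"
    and sub: "\<And>s y. 0 < s \<Longrightarrow> s \<notin> N \<Longrightarrow> J y < \<infinity> \<Longrightarrow>
           enn2real (J (w s)) + g s \<bullet> (w s - y) \<le> enn2real (J y)"
    by (rule gradient_solution_ae_subgradient[OF w]) blast
  have cont: "continuous_on {0..} w" using w unfolding gradient_solution_def by blast
  define \<phi> where "\<phi> r = (norm (w q - y))\<^sup>2 / 2 - (norm (w r - y))\<^sup>2 / 2
           - (q - r) * (enn2real (J y) - enn2real (J (w q)))" for r
  have pos: "\<phi> r \<le> 0" if r: "0 < r" "r < q" for r
  proof -
    have "(norm (w q - y))\<^sup>2 / 2 - (norm (w r - y))\<^sup>2 / 2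
       \<le> (enn2real (J y) - enn2real (J (w q))) * (q - r)"
    proof (rule half_norm_increment_le[OF _ _ _ H1_loc_dominated[OF g] norm_le_one_plus_square N])
      show "(w s - y) \<bullet> g s \<le> enn2real (J y) - enn2real (J (w q))"
        if s: "r < s" "s < q" "s \<notin> N" for s
      proof -
        have "enn2real (J (w q)) \<le> enn2real (J (w s))"
          using gradient_solution_energy_antimono[OF lsc w, of s q]
            gradient_solution_finite_energy[OF lsc w, of s] s r by (intro enn2real_mono) auto
        then show ?thesis using sub[OF _ s(3) y] s r by (simp add: inner_commute)
      qed
    qed (use r g in \<open>auto simp: H1_loc_with_derivative_def intro: continuous_on_subset[OF cont]\<close>)
    then show ?thesis by (simp add: \<phi>_def mult.commute)
  qed
  have "\<phi> p \<le> 0"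
  proof (rule tendsto_upperbound)
    have "continuous_on {p..q} \<phi>" unfolding \<phi>_def
      using pq by (intro continuous_intros continuous_on_subset[OF cont]) auto
    then show "(\<phi> \<longlongrightarrow> \<phi> p) (at_right p)" using pq(2) continuous_on_Icc_at_rightD by blast
    show "\<forall>\<^sub>F r in at_right p. \<phi> r \<le> 0"
      using pos pq by (auto simp: eventually_at_right_field intro!: exI[of _ q])
  qed simp
  then show ?thesis by (simp add: \<phi>_def)
qed

text \<open>The shifted curve solves the same inclusion. Adding the two subgradient inequalities, each tested
  with the other point, shows that the subdifferential is monotone, so the distance between the two
  curves cannot grow.\<close>

lemma gradient_solution_contraction:
  assumes w: "gradient_solution J w" and pq: "0 \<le> p" "p \<le> q" and h: "0 < h"
  shows "norm (w (q + h) - w q) \<le> norm (w (p + h) - w p)"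
proof (cases "p = q")
  case False
  obtain g N where g: "H1_loc_with_derivative w g" and N: "negligible N"
    and fin: "\<And>s. 0 < s \<Longrightarrow> s \<notin> N \<Longrightarrow> J (w s) < \<infinity>"
    and sub: "\<And>s y. 0 < s \<Longrightarrow> s \<notin> N \<Longrightarrow> J y < \<infinity> \<Longrightarrow>
           enn2real (J (w s)) + g s \<bullet> (w s - y) \<le> enn2real (J y)"
    by (rule gradient_solution_ae_subgradient[OF w]) blast
  have cont: "continuous_on {0..} w" using w unfolding gradient_solution_def by blast
  define z where "z s = w (s + h) - w s" for s
  have z_cont: "continuous_on {0..} z" unfolding z_def
    using h by (intro continuous_intros continuous_on_compose2[OF cont]) auto
  define M where "M = N \<union> (+) (-h) ` N"
  have M: "negligible M" unfolding M_def by (intro negligible_Un negligible_translation N)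
  have pos: "norm (z q) \<le> norm (z r)" if r: "0 < r" "r < q" for r
  proof -
    have "(norm (z q - 0))\<^sup>2 / 2 - (norm (z r - 0))\<^sup>2 / 2 \<le> 0 * (q - r)"
    proof (rule half_norm_increment_le[where G = "\<lambda>s. (1 + (norm (g (s + h)))\<^sup>2) + (1 + (norm (g s))\<^sup>2)"
            and f = "\<lambda>s. g (s + h) - g s" and N = M])
      show "((\<lambda>s. g (s + h) - g s) has_integral z c - z a) {a..c}"
        if "r \<le> a" "a < c" "c \<le> q" for a c
      proof -
        have "(g has_integral w c - w a) {a..c}" "(g has_integral w (c+h) - w (a+h)) {a+h..c+h}"
          using g that r h unfolding H1_loc_with_derivative_def by auto
        moreover from has_integral_shift_real_ivl[OF this(2), of h]
        have "((\<lambda>s. g (s + h)) has_integral w (c+h) - w (a+h)) {a..c}" by simp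
        ultimately have "((\<lambda>s. g (s + h) - g s) has_integral (w (c+h) - w (a+h)) - (w c - w a)) {a..c}"
          by (intro has_integral_diff)
        then show ?thesis by (simp add: z_def algebra_simps)
      qed
      show "(\<lambda>s. (1 + (norm (g (s + h)))\<^sup>2) + (1 + (norm (g s))\<^sup>2)) integrable_on {r..q}"
      proof (rule integrable_add)
        show "(\<lambda>s. 1 + (norm (g (s + h)))\<^sup>2) integrable_on {r..q}"
          using integrable_shift_real_ivl[OF H1_loc_dominated[OF g, of "r + h" "q + h"], of h] r h by simp
        show "(\<lambda>s. 1 + (norm (g s))\<^sup>2) integrable_on {r..q}"
          using r by (intro H1_loc_dominated[OF g]) auto
      qed
      show "norm (g (s + h) - g s) \<le> (1 + (norm (g (s + h)))\<^sup>2) + (1 + (norm (g s))\<^sup>2)" for s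
        by (intro norm_triangle_le_diff add_mono norm_le_one_plus_square)
      show "(z s - 0) \<bullet> (g (s + h) - g s) \<le> 0" if s: "r < s" "s < q" "s \<notin> M" for s
      proof -
        have N: "s \<notin> N" "s + h \<notin> N" using s(3) by (auto simp: M_def image_iff)
        have s0: "0 < s" "0 < s + h" using s r h by auto
        show ?thesis
          using sub[OF s0(1) N(1) fin[OF s0(2) N(2)]] sub[OF s0(2) N(2) fin[OF s0(1) N(1)]]
          by (simp add: z_def inner_diff_left inner_diff_right inner_commute)
      qed
    qed (use r M in \<open>auto intro: continuous_on_subset[OF z_cont]\<close>)
    then show ?thesis by simp
  qed
  have "norm (z q) \<le> norm (z p)"
  proof (rule tendsto_lowerbound)
    have "continuous_on {p..q} (\<lambda>r. norm (z r))"
      using pq by (intro continuous_intros continuous_on_subset[OF z_cont]) auto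
    then show "((\<lambda>r. norm (z r)) \<longlongrightarrow> norm (z p)) (at_right p)"
      using pq False continuous_on_Icc_at_rightD by fastforce
    show "\<forall>\<^sub>F r in at_right p. norm (z q) \<le> norm (z r)"
      using pos pq False by (auto simp: eventually_at_right_field intro!: exI[of _ q])
  qed simp
  then show ?thesis by (simp add: z_def)
qed simp

section \<open>Curves of steepest descent\<close>

text \<open>All that the rest of the argument uses about a gradient curve.\<close>

locale evi_curve =
  fixes J :: "'a::{real_inner,complete_space} \<Rightarrow> ennreal" and w :: "real \<Rightarrow> 'a"
  assumes lsc: "lower_semicontinuous J"
    and cont: "continuous_on {0..} w"
    and finite_energy: "\<And>s. 0 \<le> s \<Longrightarrow> J (w s) < \<infinity>"
    and evi: "\<And>p q y. 0 \<le> p \<Longrightarrow> p < q \<Longrightarrow> J y < \<infinity> \<Longrightarrow>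
           (norm (w q - y))\<^sup>2 / 2 - (norm (w p - y))\<^sup>2 / 2
             \<le> (q - p) * (enn2real (J y) - enn2real (J (w q)))"
    and contraction: "\<And>p q h. 0 \<le> p \<Longrightarrow> p \<le> q \<Longrightarrow> 0 < h \<Longrightarrow>
           norm (w (q + h) - w q) \<le> norm (w (p + h) - w p)"
begin

definition energy :: "real \<Rightarrow> real" where
  "energy s = enn2real (J (w s))"

lemma J_eq_energy: "0 \<le> s \<Longrightarrow> J (w s) = ennreal (energy s)"
  using finite_energy by (simp add: energy_def)

lemma energy_nonneg: "0 \<le> energy s"
  by (simp add: energy_def)

lemma evi_energy:
  assumes "0 \<le> p" "p < q" "0 \<le> s"
  shows "(norm (w q - w s))\<^sup>2 / 2 - (norm (w p - w s))\<^sup>2 / 2 \<le> (q - p) * (energy s - energy q)"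
  using evi[OF assms(1,2) finite_energy[OF assms(3)]] by (simp add: energy_def)

lemma energy_antimono: 
  assumes "0 \<le> p" "p \<le> q"
  shows "energy q \<le> energy p"
proof (cases "p = q")
  case False
  then have "0 \<le> (q - p) * (energy p - energy q)"
    using evi_energy[of p q p] assms by (smt (verit) norm_zero cancel_comm_monoid_add_class.diff_cancel
        power_zero_numeral divide_eq_0_iff zero_le_power2 divide_nonneg_pos)
  then show ?thesis using False assms by (simp add: zero_le_mult_iff)
qed simp

lemma energy_tendsto_at_right:
  assumes "0 \<le> s"
  shows "(energy \<longlongrightarrow> energy s) (at_right s)"
proof (rule order_tendstoI)
  fix a assume a: "a < energy s"
  have "\<exists>r>s. a < energy r"
  proof (rule ccontr)
    assume "\<not> ?thesis"
    then have le: "energy r \<le> a" if "r > s" for r using that by force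
    have "(w \<longlongrightarrow> w s) (at_right s)"
      using cont assms by (auto simp: continuous_on_def intro: tendsto_within_subset)
    moreover have "\<forall>\<^sub>F r in at_right s. J (w r) \<le> ennreal a"
      unfolding eventually_at_filter
      using le assms by (auto simp: J_eq_energy intro!: always_eventually ennreal_leI)
    ultimately have "J (w s) \<le> ennreal a"
      by (intro lower_semicontinuous_le_limit[OF lsc _ _ tendsto_const]) auto
    moreover have "0 \<le> a" using le[of "s + 1"] energy_nonneg[of "s + 1"] by linarith
    ultimately show False using a assms by (simp add: J_eq_energy)
  qed
  then obtain r where r: "s < r" "a < energy r" by blast
  show "\<forall>\<^sub>F x in at_right s. a < energy x"
    unfolding eventually_at_right_field
    using r assms energy_antimono by (meson le_less_trans less_imp_le less_le_trans)
next
  fix a assume a: "energy s < a"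
  have "energy x < a" if "s < x" for x
    using energy_antimono[of s x] assms that a by linarith
  then show "\<forall>\<^sub>F x in at_right s. energy x < a"
    by (auto simp: eventually_at_filter)
qed

lemma closed_energy_le:
  assumes "0 \<le> a" and c: "continuous_on {a..b} c"
  shows "closed {s \<in> {a..b}. energy s \<le> c s}"
proof -
  have "{s \<in> {a..b}. energy s \<le> c s}
      = {s \<in> {a..b}. J (w s) \<le> ennreal (c s)} \<inter> {s \<in> {a..b}. 0 \<le> c s}"
    using assms(1) energy_nonneg by (auto simp: J_eq_energy intro: order_trans ennreal_leI)
  moreover have "continuous_on {a..b} w"
    using cont assms(1) by (auto intro: continuous_on_subset)
  then have "closed {s \<in> {a..b}. J (w s) \<le> ennreal (c s)}"
    by (intro closed_sublevel_along_curve lsc c)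
  moreover have "closed {s \<in> {a..b}. 0 \<le> c s}"
    by (intro continuous_on_closed_Collect_le continuous_on_const c closed_atLeastAtMost)
  ultimately show ?thesis by auto
qed

text \<open>To prove that \<open>energy + \<psi>\<close> does not increase from \<open>a\<close> to \<open>b\<close>, it suffices to find, from every
  intermediate point, some step to the right along which it does not increase; the steps may be
  arbitrarily short. The left end \<open>a\<close> is approached from inside the interval.\<close>

lemma energy_descent:
  assumes ab: "0 \<le> a" "a \<le> b" and \<psi>: "continuous_on {a..b} \<psi>"
    and step: "\<And>s. a < s \<Longrightarrow> s < b \<Longrightarrow>
                 \<exists>s'. s < s' \<and> s' \<le> b \<and> energy s' + \<psi> s' \<le> energy s + \<psi> s"
  shows "energy b + \<psi> b \<le> energy a + \<psi> a"
proof (cases "a = b")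
  case False
  have from_inside: "energy b + \<psi> b \<le> energy a + \<psi> r" if r: "a < r" "r < b" for r
  proof -
    have "energy b \<le> energy r + \<psi> r - \<psi> b"
    proof (rule closed_property_reaches_right_end[of r b "\<lambda>s. energy s \<le> energy r + \<psi> r - \<psi> s"])
      show "closed {s \<in> {r..b}. energy s \<le> energy r + \<psi> r - \<psi> s}"
        using ab r by (intro closed_energy_le continuous_intros continuous_on_subset[OF \<psi>]) auto
      show "\<exists>s'>s. s' \<le> b \<and> energy s' \<le> energy r + \<psi> r - \<psi> s'"
        if "r \<le> s" "s < b" "energy s \<le> energy r + \<psi> r - \<psi> s" for s
        using step[of s] that r by force
    qed (use r in auto)
    moreover have "energy r \<le> energy a" using ab r by (intro energy_antimono) auto
    ultimately show ?thesis by linarith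
  qed
  show ?thesis
  proof (rule tendsto_lowerbound)
    have "(\<psi> \<longlongrightarrow> \<psi> a) (at_right a)" using \<psi> ab False by (intro continuous_on_Icc_at_rightD) auto
    then show "((\<lambda>r. energy a + \<psi> r) \<longlongrightarrow> energy a + \<psi> a) (at_right a)"
      by (intro tendsto_intros)
    show "\<forall>\<^sub>F r in at_right a. energy b + \<psi> b \<le> energy a + \<psi> r"
      using from_inside ab False by (auto simp: eventually_at_right_field intro!: exI[of _ b])
  qed simp
qed simp

text \<open>By contraction an increment of \<open>w\<close> after \<open>s\<close> is at most the increment over a step of the same
  length starting at \<open>s\<close>, so short steps at \<open>s\<close> alone control \<open>w\<close> on all of \<open>[s,\<infinity>)\<close>.\<close>

lemma lipschitz_on_ray_if_initial_increments:
  assumes s: "0 \<le> s" and \<eta>: "0 < \<eta>"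
    and incr: "\<And>h. 0 < h \<Longrightarrow> h \<le> \<eta> \<Longrightarrow> norm (w (s + h) - w s) \<le> c * h"
  shows "c-lipschitz_on {s..} w"
proof (rule lipschitz_on_leI)
  show "0 \<le> c"
    using incr[OF \<eta> order_refl] \<eta> by (metis norm_ge_zero order_trans zero_le_mult_iff not_le)
  fix p q assume pq: "p \<in> {s..}" "q \<in> {s..}" "p \<le> q"
  define \<phi> where "\<phi> r = norm (w r - w p) - c * r" for r
  have "\<phi> q \<le> \<phi> p"
  proof (rule le_if_fine_increments_small[OF pq(3), where G = "\<lambda>_. 0"])
    have "\<phi> b \<le> \<phi> a" if ab: "p \<le> a" "a < b" "b - a \<le> \<eta>" for a b
    proof -
      have "norm (w b - w a) \<le> norm (w (s + (b - a)) - w s)"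
        using contraction[of s a "b - a"] ab pq s by simp
      then have "norm (w b - w a) \<le> c * (b - a)" using incr[of "b - a"] ab by simp
      moreover have "norm (w b - w p) \<le> norm (w b - w a) + norm (w a - w p)"
        using norm_triangle_ineq[of "w b - w a" "w a - w p"] by simp
      ultimately show ?thesis by (simp add: \<phi>_def algebra_simps)
    qed
    then show "\<exists>\<delta>>0. \<forall>a b. p \<le> a \<and> a < b \<and> b \<le> q \<and> b - a \<le> \<delta> \<longrightarrow> \<phi> b - \<phi> a \<le> \<epsilon> * (0 - 0)"
      for \<epsilon> :: real using \<eta> by auto
  qed
  then show "dist (w p) (w q) \<le> c * dist p q"
    using pq by (simp add: \<phi>_def dist_norm norm_minus_commute algebra_simps)
qed

text \<open>Summing the variational inequality with test point \<open>w(s)\<close> over a partition of \<open>[s,s+h]\<close> gives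
  \<open>\<parallel>w(s+h) - w(s)\<parallel>\<^sup>2 / 2 \<le> \<integral>\<^sub>0\<^sup>h \<rho> r dr\<close>. A single application on \<open>[s,s+h]\<close> would lose a factor \<open>2\<close>,
  which the sharp comparison of speed and energy decay cannot afford.\<close>

lemma square_increment_le:
  assumes s: "0 \<le> s" and h: "0 \<le> h"
    and slope: "\<And>r. 0 < r \<Longrightarrow> r \<le> h \<Longrightarrow> energy s - energy (s + r) \<le> \<rho> * r"
  shows "(norm (w (s + h) - w s))\<^sup>2 \<le> \<rho> * h\<^sup>2"
proof -
  define \<phi> where "\<phi> r = (norm (w r - w s))\<^sup>2 / 2 - \<rho> * (r - s)\<^sup>2 / 2" for r
  have "\<phi> (s + h) \<le> \<phi> s"
  proof (rule le_if_fine_increments_small[of s "s + h" \<phi> "\<lambda>r. \<bar>\<rho>\<bar> * r"])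
    fix \<epsilon> :: real assume \<epsilon>: "0 < \<epsilon>"
    have "\<phi> q - \<phi> p \<le> \<epsilon> * (\<bar>\<rho>\<bar> * q - \<bar>\<rho>\<bar> * p)"
      if pq: "s \<le> p" "p < q" "q \<le> s + h" "q - p \<le> \<epsilon>" for p q
    proof -
      have "(norm (w q - w s))\<^sup>2 / 2 - (norm (w p - w s))\<^sup>2 / 2 \<le> (q - p) * (energy s - energy q)"
        using s pq by (intro evi_energy) auto
      also have "\<dots> \<le> (q - p) * (\<rho> * (q - s))"
        using slope[of "q - s"] pq by (intro mult_left_mono) auto
      also have "\<dots> = \<rho> * (q - s)\<^sup>2 / 2 - \<rho> * (p - s)\<^sup>2 / 2 + (q - p) * (\<rho> * (q - p) / 2)"
        by (simp add: power2_eq_square field_simps)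
      also have "(q - p) * (\<rho> * (q - p) / 2) \<le> (q - p) * (\<bar>\<rho>\<bar> * \<epsilon>)"
      proof (rule mult_left_mono)
        have "\<rho> * (q - p) \<le> \<bar>\<rho>\<bar> * \<epsilon>" using pq by (intro mult_mono) auto
        moreover have "0 \<le> \<bar>\<rho>\<bar> * \<epsilon>" using \<epsilon> by simp
        ultimately show "\<rho> * (q - p) / 2 \<le> \<bar>\<rho>\<bar> * \<epsilon>" by linarith
      qed (use pq in simp)
      finally show ?thesis by (simp add: \<phi>_def algebra_simps)
    qed
    then show "\<exists>\<delta>>0. \<forall>p q. s \<le> p \<and> p < q \<and> q \<le> s + h \<and> q - p \<le> \<delta> \<longrightarrow>
                 \<phi> q - \<phi> p \<le> \<epsilon> * (\<bar>\<rho>\<bar> * q - \<bar>\<rho>\<bar> * p)"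
      using \<epsilon> by (intro exI[of _ \<epsilon>]) auto
  qed (use h in simp)
  then show ?thesis by (simp add: \<phi>_def)
qed

text \<open>The square of the speed at \<open>s\<close> is at most the rate of energy decay at \<open>s\<close>.\<close>

lemma lipschitz_on_ray_if_energy_slope:
  assumes s: "0 \<le> s" and \<eta>: "0 < \<eta>"
    and slope: "\<And>r. 0 < r \<Longrightarrow> r \<le> \<eta> \<Longrightarrow> energy s - energy (s + r) \<le> \<rho> * r"
  shows "(sqrt \<rho>)-lipschitz_on {s..} w"
proof (rule lipschitz_on_ray_if_initial_increments[OF s \<eta>])
  fix h :: real assume h: "0 < h" "h \<le> \<eta>"
  then have "(norm (w (s + h) - w s))\<^sup>2 \<le> \<rho> * h\<^sup>2" by (intro square_increment_le s slope) auto
  then have "norm (w (s + h) - w s) \<le> sqrt (\<rho> * h\<^sup>2)" by (rule real_le_rsqrt)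
  then show "norm (w (s + h) - w s) \<le> sqrt \<rho> * h" using h by (simp add: real_sqrt_mult)
qed

text \<open>As long as \<open>w\<close> is not \<open>c\<close>-Lipschitz on the future, the energy decays faster than \<open>c\<^sup>2\<close> per unit of
  time, which it can sustain only until it is used up. With \<open>c\<close> large this shows that the speed is
  finite at positive times, with \<open>b\<close> large that the speed tends to \<open>0\<close>.\<close>

lemma ex_lipschitz_on_ray:
  assumes c: "0 < c" and b: "energy 0 < c\<^sup>2 * b" "0 \<le> b"
  obtains s where "0 < s" "s < b" "c-lipschitz_on {s..} w"
proof -
  have "\<exists>s. 0 < s \<and> s < b \<and> c-lipschitz_on {s..} w"
  proof (rule ccontr)
    assume none: "\<not> ?thesis"
    have "energy b + c\<^sup>2 * b \<le> energy 0 + c\<^sup>2 * 0"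
    proof (rule energy_descent[of 0 b "\<lambda>s. c\<^sup>2 * s"])
      fix s assume s: "0 < s" "s < b"
      have "\<exists>r>0. r \<le> b - s \<and> energy s - energy (s + r) > c\<^sup>2 * r"
      proof (rule ccontr)
        assume "\<not> ?thesis"
        then have "(sqrt (c\<^sup>2))-lipschitz_on {s..} w"
          using s by (intro lipschitz_on_ray_if_energy_slope[of s "b - s"]) force+
        then show False using none s c by simp
      qed
      then obtain r where "0 < r" "r \<le> b - s" "energy s - energy (s + r) > c\<^sup>2 * r" by blast
      then show "\<exists>s'>s. s' \<le> b \<and> energy s' + c\<^sup>2 * s' \<le> energy s + c\<^sup>2 * s"
        by (intro exI[of _ "s + r"]) (auto simp: algebra_simps)
    qed (use b in \<open>simp_all add: continuous_on_mult_left\<close>)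
    then show False using b energy_nonneg[of b] by simp
  qed
  then show thesis using that by blast
qed

lemma lipschitz_on_later_ray: "c-lipschitz_on {s..} w \<Longrightarrow> s \<le> s' \<Longrightarrow> c-lipschitz_on {s'..} w"
  by (erule lipschitz_on_subset) auto

lemma ex_lipschitz_constant:
  assumes "0 < s"
  shows "\<exists>c. c-lipschitz_on {s..} w"
proof -
  have pos: "0 < (energy 0 + 1) / s" using assms energy_nonneg[of 0] by (intro divide_pos_pos) auto
  have "energy 0 < (sqrt ((energy 0 + 1) / s))\<^sup>2 * s"
    using pos assms by simp
  with pos assms obtain s' where "s' < s" "(sqrt ((energy 0 + 1) / s))-lipschitz_on {s'..} w"
    by (rule_tac ex_lipschitz_on_ray[of "sqrt ((energy 0 + 1) / s)" s]) auto
  then show ?thesis using lipschitz_on_later_ray[of _ s' s] by auto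
qed

text \<open>On \<open>[s,q]\<close> the curve moves by at most \<open>c * (q - s)\<close>, so the squared distance to \<open>v\<close> falls at a rate of
  at most \<open>2 * c * \<parallel>v - w(s)\<parallel>\<close>. The variational inequality turns this into the bound for the energy at \<open>q\<close>;
  then \<open>q\<close> tends to \<open>s\<close>.\<close>

lemma energy_stable:
  assumes s: "0 \<le> s" and lip: "c-lipschitz_on {s..} w" and v: "J v < \<infinity>"
  shows "energy s \<le> enn2real (J v) + c * norm (v - w s)"
proof (rule tendsto_upperbound)
  show "((\<lambda>h. energy h) \<longlongrightarrow> energy s) (at_right s)" using energy_tendsto_at_right[OF s] .
  have "energy q \<le> enn2real (J v) + c * norm (v - w s)" if q: "s < q" for q
  proof -
    have "norm (w s - v) * norm (w q - w s) \<le> norm (w s - v) * (c * (q - s))"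
      using lipschitz_on_normD[OF lip, of q s] q by (intro mult_left_mono) simp_all
    moreover have "- (norm (w s - v) * norm (w q - w s)) \<le> (w s - v) \<bullet> (w q - w s)"
      using abs_le_D2[OF Cauchy_Schwarz_ineq2[of "w s - v" "w q - w s"]] by (subst minus_le_iff)
    moreover have "(norm (w q - v))\<^sup>2 = (norm (w s - v))\<^sup>2 + 2 * ((w s - v) \<bullet> (w q - w s))
        + (norm (w q - w s))\<^sup>2"
      using dot_norm[of "w s - v" "w q - w s"] by simp
    moreover have "0 \<le> (norm (w q - w s))\<^sup>2" by simp
    moreover have "(norm (w q - v))\<^sup>2 / 2 - (norm (w s - v))\<^sup>2 / 2 \<le> (q - s) * (enn2real (J v) - energy q)"
      using evi[OF s q v] by (simp add: energy_def)
    ultimately have "- (norm (w s - v) * (c * (q - s))) \<le> (q - s) * (enn2real (J v) - energy q)"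
      by linarith
    then have "0 \<le> (q - s) * (enn2real (J v) - energy q + c * norm (v - w s))"
      by (simp add: algebra_simps norm_minus_commute)
    then show ?thesis using q by (simp add: zero_le_mult_iff)
  qed
  then show "\<forall>\<^sub>F q in at_right s. energy q \<le> enn2real (J v) + c * norm (v - w s)"
    by (auto simp: eventually_at_filter)
qed simp

text \<open>Let \<open>L > c\<close> be the least Lipschitz constant on \<open>[s,\<infinity>)\<close>. If the energy fell by at most \<open>c\<close> times the
  distance travelled on all short steps from \<open>s\<close>, its slope would be at most \<open>c * L\<close>, and the speed
  at most \<open>sqrt (c * L) < L\<close>. So some short steps satisfy the claim, and \<open>energy_descent\<close> joins them.\<close>

lemma energy_dissipation:
  assumes ab: "0 \<le> a" "a \<le> b" and c: "0 \<le> c"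
    and fast: "\<And>s. a < s \<Longrightarrow> s < b \<Longrightarrow> \<not> c-lipschitz_on {s..} w"
  shows "energy b + c * norm (w b - w a) \<le> energy a"
proof -
  have "energy b + c * norm (w b - w a) \<le> energy a + c * norm (w a - w a)"
  proof (rule energy_descent[OF ab, of "\<lambda>s. c * norm (w s - w a)"])
    show "continuous_on {a..b} (\<lambda>s. c * norm (w s - w a))"
      using ab by (intro continuous_on_mult_left continuous_on_norm continuous_on_diff
          continuous_on_const continuous_on_subset[OF cont]) auto
    fix s assume s: "a < s" "s < b"
    obtain C where "C-lipschitz_on {s..} w" using ex_lipschitz_constant[of s] s ab by auto
    then obtain L where L: "L-lipschitz_on {s..} w" "\<And>c. c-lipschitz_on {s..} w \<Longrightarrow> L \<le> c"
      by (rule least_lipschitz_constant) blast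
    have "c < L" using L(1) fast[OF s] lipschitz_on_le not_le by blast
    have "\<exists>r>0. r \<le> b - s \<and> energy s - energy (s + r) > c * norm (w (s + r) - w s)"
    proof (rule ccontr)
      assume no: "\<not> ?thesis"
      have "(sqrt (c * L))-lipschitz_on {s..} w"
      proof (rule lipschitz_on_ray_if_energy_slope[of s "b - s"])
        fix r assume r: "0 < r" "r \<le> b - s"
        then have "energy s - energy (s + r) \<le> c * norm (w (s + r) - w s)" using no by force
        also have "\<dots> \<le> c * (L * r)"
          using lipschitz_on_normD[OF L(1), of "s + r" s] r c
          by (intro mult_left_mono) simp_all
        finally show "energy s - energy (s + r) \<le> c * L * r" by (simp add: mult.assoc)
      qed (use s ab in auto)
      then have "L \<le> sqrt (c * L)" by (rule L(2))
      moreover have "sqrt (c * L) < sqrt (L * L)"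
        using \<open>c < L\<close> c by (intro real_sqrt_less_mono mult_strict_right_mono) auto
      ultimately show False using \<open>c < L\<close> c by (simp add: abs_of_pos)
    qed
    then obtain r where r: "0 < r" "r \<le> b - s" "energy s - energy (s + r) > c * norm (w (s + r) - w s)"
      by blast
    have "norm (w (s + r) - w a) \<le> norm (w (s + r) - w s) + norm (w s - w a)"
      using norm_triangle_ineq[of "w (s + r) - w s" "w s - w a"] by simp
    then have "c * norm (w (s + r) - w a) \<le> c * norm (w (s + r) - w s) + c * norm (w s - w a)"
      using c by (metis distrib_left mult_left_mono)
    then show "\<exists>s'>s. s' \<le> b \<and> energy s' + c * norm (w s' - w a) \<le> energy s + c * norm (w s - w a)"
      using r by (intro exI[of _ "s + r"]) auto
  qed
  then show ?thesis by simp
qed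

text \<open>Let \<open>v(h)\<close> be the difference quotients and \<open>L\<close> the least Lipschitz constant on \<open>[s,\<infinity>)\<close>, so that
  \<open>\<parallel>v(h)\<parallel> \<le> L\<close>. The variational inequality with test point \<open>w(s+k)\<close> bounds \<open>v(h) \<bullet> v(k)\<close> from below by
  the slope of the energy on \<open>[s,s+k]\<close>, up to an error that vanishes with \<open>h\<close>. For suitable \<open>k\<close> this slope
  comes as close to \<open>L\<^sup>2\<close> as desired, since otherwise \<open>L\<close> would not be least. Vectors in the ball of
  radius \<open>L\<close> whose inner product with \<open>v(k)\<close> is nearly \<open>L\<^sup>2\<close> are near \<open>v(k)\<close>, so the quotients are
  Cauchy as \<open>h\<close> tends to \<open>0\<close>.\<close>

lemma right_difference_quotient_converges:
  assumes s: "0 < s"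
  shows "\<exists>v. ((\<lambda>h. (1 / h) *\<^sub>R (w (s + h) - w s)) \<longlongrightarrow> v) (at_right 0)"
proof -
  define v where "v h = (1 / h) *\<^sub>R (w (s + h) - w s)" for h
  obtain C where "C-lipschitz_on {s..} w" using ex_lipschitz_constant[OF s] by blast
  then obtain L where L: "L-lipschitz_on {s..} w" "\<And>c. c-lipschitz_on {s..} w \<Longrightarrow> L \<le> c"
    by (rule least_lipschitz_constant) blast
  have L0: "0 \<le> L" using L(1) by (rule lipschitz_on_nonneg)
  have v_le: "norm (v h) \<le> L" if "0 < h" for h
    using lipschitz_onD[OF L(1), of "s + h" s] that by (simp add: v_def dist_norm divide_le_eq)
  have inner_ge: "energy (s + h) - energy (s + k) \<le> k * (v h \<bullet> v k)" if hk: "0 < h" "0 < k" for h k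
  proof -
    define A B where "A = w (s + h) - w s" and "B = w (s + k) - w s"
    have "(norm (A - B))\<^sup>2 / 2 - (norm B)\<^sup>2 / 2 \<le> h * (energy (s + k) - energy (s + h))"
      using evi_energy[of s "s + h" "s + k"] s hk
      by (simp add: A_def B_def norm_minus_commute[of "w s"])
    moreover have "(norm (A - B))\<^sup>2 = (norm A)\<^sup>2 - 2 * (A \<bullet> B) + (norm B)\<^sup>2"
      using dot_norm_neg[of A B] by simp
    moreover have "0 \<le> (norm A)\<^sup>2" by simp
    ultimately have "h * (energy (s + h) - energy (s + k)) \<le> A \<bullet> B"
      unfolding right_diff_distrib by linarith
    also have "A \<bullet> B = h * k * (v h \<bullet> v k)" using hk by (simp add: v_def A_def B_def)
    finally have "h * (energy (s + h) - energy (s + k)) \<le> h * (k * (v h \<bullet> v k))"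
      by (simp only: mult.assoc)
    then show ?thesis using hk(1) by (rule mult_left_le_imp_le)
  qed
  have "cauchy_filter (filtermap v (at_right 0))"
    unfolding cauchy_filter_metric_filtermap
  proof (intro allI impI)
    fix e :: real assume e: "0 < e"
    \<comment> \<open>The distance to \<open>v k\<close> will be at most the square root of \<open>4 * \<epsilon>\<close>, which must be below \<open>e / 2\<close>.\<close>
    define \<epsilon> where "\<epsilon> = e\<^sup>2 / 20"
    have \<epsilon>: "0 < \<epsilon>" using e by (simp add: \<epsilon>_def)
    have "\<exists>k>0. energy s - energy (s + k) > (L\<^sup>2 - \<epsilon>) * k"
    proof (rule ccontr)
      assume "\<not> ?thesis"
      then have "(sqrt (L\<^sup>2 - \<epsilon>))-lipschitz_on {s..} w"
        using s by (intro lipschitz_on_ray_if_energy_slope[of s 1]) force+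
      then have "L \<le> sqrt (L\<^sup>2 - \<epsilon>)" by (rule L(2))
      moreover have "sqrt (L\<^sup>2 - \<epsilon>) < sqrt (L\<^sup>2)" using \<epsilon> by (intro real_sqrt_less_mono) simp
      ultimately show False using L0 by simp
    qed
    then obtain k where k: "0 < k" "energy s - energy (s + k) > (L\<^sup>2 - \<epsilon>) * k" by blast
    have "((\<lambda>h. energy (s + h)) \<longlongrightarrow> energy s) (at_right 0)"
      using energy_tendsto_at_right[of s] s by (simp add: filterlim_at_right_to_0[of _ _ s] add.commute)
    then have ev: "\<forall>\<^sub>F h in at_right 0. energy s - \<epsilon> * k < energy (s + h)"
      using \<epsilon> k(1) by (intro order_tendstoD) auto
    have near: "dist (v h) (v k) < e / 2" if h: "0 < h" "energy s - \<epsilon> * k < energy (s + h)" for h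
    proof -
      have "k * (L\<^sup>2 - 2 * \<epsilon>) \<le> energy (s + h) - energy (s + k)"
        using h(2) k(2) by (simp add: algebra_simps)
      also have "\<dots> \<le> k * (v h \<bullet> v k)" using h(1) k(1) by (rule inner_ge)
      finally have "L\<^sup>2 - 2 * \<epsilon> \<le> v h \<bullet> v k" using k(1) by (rule mult_left_le_imp_le)
      moreover have "(norm (v h - v k))\<^sup>2 = (norm (v h))\<^sup>2 - 2 * (v h \<bullet> v k) + (norm (v k))\<^sup>2"
        using dot_norm_neg[of "v h" "v k"] by simp
      moreover have "(norm (v h))\<^sup>2 \<le> L\<^sup>2" "(norm (v k))\<^sup>2 \<le> L\<^sup>2"
        using v_le h(1) k(1) by (auto intro: power_mono)
      ultimately have "(norm (v h - v k))\<^sup>2 \<le> 4 * \<epsilon>" by linarith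
      moreover have "4 * \<epsilon> < (e / 2)\<^sup>2" using e by (simp add: \<epsilon>_def power2_eq_square)
      ultimately have "(norm (v h - v k))\<^sup>2 < (e / 2)\<^sup>2" by (rule le_less_trans)
      moreover have "0 \<le> e / 2" using e by simp
      ultimately have "norm (v h - v k) < e / 2" by (rule power2_less_imp_less)
      then show ?thesis by (simp add: dist_norm)
    qed
    have "\<forall>\<^sub>F h in at_right 0. 0 < h \<and> energy s - \<epsilon> * k < energy (s + h)"
      using ev eventually_at_right_less by (rule eventually_conj[rotated])
    moreover have "dist (v x) (v y) < e"
      if "0 < x \<and> energy s - \<epsilon> * k < energy (s + x)" "0 < y \<and> energy s - \<epsilon> * k < energy (s + y)" for x y
      using near[of x] near[of y] that dist_triangle_half_l[of "v x" "v k" e "v y"] by (simp add: dist_commute)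
    ultimately show "\<exists>P. eventually P (at_right 0) \<and> (\<forall>x y. P x \<and> P y \<longrightarrow> dist (v x) (v y) < e)"
      by blast
  qed
  then obtain l where "filtermap v (at_right 0) \<le> nhds l"
    using cauchy_filter_complete_converges[OF _ complete_UNIV, of "filtermap v (at_right 0)"]
    by (auto simp: filtermap_bot_iff)
  then show ?thesis unfolding v_def filterlim_def by blast
qed

lemma norm_right_deriv_le_iff:
  assumes s: "0 < s" and c: "0 \<le> c"
  shows "norm (right_deriv w s) \<le> c \<longleftrightarrow> c-lipschitz_on {s..} w"
proof -
  obtain v where v: "((\<lambda>h. (1 / h) *\<^sub>R (w (s + h) - w s)) \<longlongrightarrow> v) (at_right 0)"
    using right_difference_quotient_converges[OF s] by blast
  have rd: "right_deriv w s = v"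
    unfolding right_deriv_def by (intro tendsto_Lim v) simp
  have lim: "((\<lambda>h. norm ((1 / h) *\<^sub>R (w (s + h) - w s))) \<longlongrightarrow> norm v) (at_right 0)"
    by (rule tendsto_norm[OF v])
  show ?thesis
  proof
    assume "norm (right_deriv w s) \<le> c"
    show "c-lipschitz_on {s..} w"
    proof (rule lipschitz_on_limit_constant[OF c])
      fix c' assume "c < c'"
      then have "\<forall>\<^sub>F h in at_right 0. norm ((1 / h) *\<^sub>R (w (s + h) - w s)) < c'"
        using \<open>norm (right_deriv w s) \<le> c\<close> rd by (intro order_tendstoD(2)[OF lim]) auto
      then obtain b where b: "0 < b" "\<And>h. 0 < h \<Longrightarrow> h < b \<Longrightarrow> norm ((1 / h) *\<^sub>R (w (s + h) - w s)) < c'"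
        unfolding eventually_at_right_field by blast
      show "c'-lipschitz_on {s..} w"
      proof (rule lipschitz_on_ray_if_initial_increments[of s "b / 2"])
        show "norm (w (s + h) - w s) \<le> c' * h" if "0 < h" "h \<le> b / 2" for h
          using b(2)[of h] that b(1) by (simp add: divide_less_eq)
      qed (use s b in auto)
    qed
  next
    assume lip: "c-lipschitz_on {s..} w"
    show "norm (right_deriv w s) \<le> c"
      unfolding rd
    proof (rule tendsto_upperbound[OF lim])
      have "norm ((1 / h) *\<^sub>R (w (s + h) - w s)) \<le> c" if "0 < h" for h
        using lipschitz_onD[OF lip, of "s + h" s] that by (simp add: dist_norm divide_le_eq)
      then show "\<forall>\<^sub>F h in at_right 0. norm ((1 / h) *\<^sub>R (w (s + h) - w s)) \<le> c"
        by (auto simp: eventually_at_filter)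
    qed simp
  qed
qed

text \<open>At \<open>0\<close> the speed is a monotone limit, hence a supremum over positive times; continuity of \<open>w\<close> carries
  the Lipschitz bound from the open to the closed half-line.\<close>

lemma right_speed_le_iff:
  assumes s: "0 \<le> s" and c: "0 \<le> c"
  shows "right_speed w s \<le> ennreal c \<longleftrightarrow> c-lipschitz_on {s..} w"
proof (cases "s = 0")
  case False
  then show ?thesis using assms by (simp add: right_speed_def norm_right_deriv_le_iff)
next
  case True
  define n where "n \<sigma> = ennreal (norm (right_deriv w \<sigma>))" for \<sigma>
  define m where "m = (SUP \<sigma>\<in>{0<..}. n \<sigma>)"
  have anti: "n \<sigma>' \<le> n \<sigma>" if "0 < \<sigma>" "\<sigma> \<le> \<sigma>'" for \<sigma> \<sigma>'
  proof -
    have "(norm (right_deriv w \<sigma>))-lipschitz_on {\<sigma>'..} w"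
      using that norm_right_deriv_le_iff[of \<sigma> "norm (right_deriv w \<sigma>)"] by (auto intro: lipschitz_on_later_ray)
    then show ?thesis using that norm_right_deriv_le_iff[of \<sigma>' "norm (right_deriv w \<sigma>)"]
      by (auto simp: n_def)
  qed
  have "(n \<longlongrightarrow> m) (at_right 0)"
  proof (rule order_tendstoI)
    fix a assume "a < m"
    then obtain \<sigma> where \<sigma>: "0 < \<sigma>" "a < n \<sigma>" unfolding m_def less_SUP_iff by auto
    then have "a < n x" if "0 < x" "x < \<sigma>" for x using anti[of x \<sigma>] that by auto
    then show "\<forall>\<^sub>F x in at_right 0. a < n x" using \<sigma>(1) by (auto simp: eventually_at_right_field)
  next
    fix a assume "m < a"
    then have "n x < a" if "0 < x" for x
      using that by (metis SUP_upper greaterThan_iff le_less_trans m_def)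
    then show "\<forall>\<^sub>F x in at_right 0. n x < a" by (auto simp: eventually_at_filter)
  qed
  then have "right_speed w 0 = m"
    unfolding right_speed_def n_def by (simp add: tendsto_Lim)
  then have "right_speed w 0 \<le> ennreal c \<longleftrightarrow> (\<forall>\<sigma>>0. c-lipschitz_on {\<sigma>..} w)"
    using c by (auto simp: m_def n_def SUP_le_iff norm_right_deriv_le_iff)
  also have "\<dots> \<longleftrightarrow> c-lipschitz_on {0..} w"
  proof
    assume lip: "\<forall>\<sigma>>0. c-lipschitz_on {\<sigma>..} w"
    have "c-lipschitz_on {0<..} w"
    proof (rule lipschitz_on_leI[OF _ c])
      show "dist (w x) (w y) \<le> c * dist x y" if "x \<in> {0<..}" "y \<in> {0<..}" "x \<le> y" for x y
        using lip that by (auto intro: lipschitz_onD[of c "{x..}"])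
    qed
    then show "c-lipschitz_on {0..} w" using lipschitz_on_closure[of c "{0<..}" w] cont by simp
  qed (auto intro: lipschitz_on_later_ray)
  finally show ?thesis using True by simp
qed

text \<open>The times \<open>s\<close> for which \<open>w\<close> is \<open>c\<close>-Lipschitz on \<open>[s,\<infinity>)\<close> form a nonempty closed ray. Its left end is
  the minimum in the definition of \<open>S\<close>, for \<open>c = 1 / t\<close>.\<close>

lemma first_lipschitz_time:
  assumes c: "0 < c"
  obtains m where "0 \<le> m" "c-lipschitz_on {m..} w"
    "\<And>s. 0 \<le> s \<Longrightarrow> c-lipschitz_on {s..} w \<Longrightarrow> m \<le> s"
proof
  define A where "A = {s. 0 \<le> s \<and> c-lipschitz_on {s..} w}"
  define m where "m = Inf A"
  have c0: "0 \<le> c" using c by simp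
  have "energy 0 < c\<^sup>2 * ((energy 0 + 1) / c\<^sup>2)" "0 \<le> (energy 0 + 1) / c\<^sup>2"
    using c energy_nonneg[of 0] by auto
  from ex_lipschitz_on_ray[OF c this] have ne: "A \<noteq> {}" unfolding A_def by (metis (lifting) empty_Collect_eq less_imp_le)
  have bdd: "bdd_below A" by (auto simp: A_def intro: bdd_belowI[of _ 0])
  show m0: "0 \<le> m" unfolding m_def using ne by (intro cInf_greatest) (auto simp: A_def)
  show "m \<le> s" if "0 \<le> s" "c-lipschitz_on {s..} w" for s
    unfolding m_def using that bdd by (intro cInf_lower) (auto simp: A_def)
  have lip: "c-lipschitz_on {x..} w" if mx: "m < x" for x
  proof -
    obtain a where "a \<in> A" "a < x" using cInf_lessD[OF ne] mx unfolding m_def by blast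
    then show ?thesis using lipschitz_on_later_ray[of c a x] by (auto simp: A_def)
  qed
  have "c-lipschitz_on {m<..} w"
  proof (rule lipschitz_on_leI[OF _ c0])
    show "dist (w x) (w y) \<le> c * dist x y" if "x \<in> {m<..}" "y \<in> {m<..}" "x \<le> y" for x y
      using lip that by (auto intro: lipschitz_onD[of c "{x..}"])
  qed
  then show "c-lipschitz_on {m..} w"
    using lipschitz_on_closure[of c "{m<..}" w] m0 by (simp add: continuous_on_subset[OF cont])
qed

end

section \<open>Energy balance from two-sided bounds\<close>

lemma variation_ge_increments:
  fixes N :: nat and \<tau> :: "nat \<Rightarrow> real"
  assumes "strict_mono_on {0..N} \<tau>" "r \<le> \<tau> 0" "\<tau> N \<le> t"
  shows "ennreal (\<Sum>j = 1..N. norm (u (\<tau> j) - u (\<tau> (j - 1)))) \<le> variation u r t"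
  unfolding variation_def using assms by (intro Sup_upper) blast

text \<open>With \<open>\<Phi> \<tau> = \<tau> * f \<tau> - \<integral>\<^sub>r\<^sup>\<tau> f\<close> both bounds say that \<open>\<parallel>u(q) - u(p)\<parallel>\<close> equals \<open>\<Phi> p - \<Phi> q\<close> up to the error
  \<open>(q - p) * (f p - f q)\<close>. Over a partition the increments of \<open>\<Phi>\<close> telescope and the errors add up to at
  most the mesh times \<open>f r - f t\<close>, so the variation of \<open>u\<close> is \<open>\<Phi> r - \<Phi> t\<close>.\<close>

lemma energy_balance:
  fixes u :: "real \<Rightarrow> 'a::real_normed_vector" and f :: "real \<Rightarrow> real"
  assumes rt: "0 \<le> r" "r < t" and f0: "\<And>\<tau>. r \<le> \<tau> \<Longrightarrow> \<tau> \<le> t \<Longrightarrow> 0 \<le> f \<tau>"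
    and anti: "\<And>p q. r \<le> p \<Longrightarrow> p \<le> q \<Longrightarrow> q \<le> t \<Longrightarrow> f q \<le> f p"
    and stable: "\<And>p q. r \<le> p \<Longrightarrow> p < q \<Longrightarrow> q \<le> t \<Longrightarrow> p * (f p - f q) \<le> norm (u q - u p)"
    and dissipation: "\<And>p q. r \<le> p \<Longrightarrow> p < q \<Longrightarrow> q \<le> t \<Longrightarrow> norm (u q - u p) \<le> q * (f p - f q)"
  shows "ennreal t * ennreal (f t) + variation u r t
       = ennreal r * ennreal (f r) + (\<integral>\<^sup>+ \<tau>. ennreal (f \<tau>) \<partial>lebesgue_on {r..t})"
proof -
  have mono: "mono_on {r..t} (\<lambda>\<tau>. - f \<tau>)" by (auto simp: mono_on_def intro: anti)
  have integrable: "integrable (lebesgue_on {r..t}) f"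
    using integrable_mono_on[OF mono] by simp
  have int: "f integrable_on {p..q}" if "r \<le> p" "q \<le> t" for p q
    using integrable_on_lebesgue_on[OF integrable] that by (auto intro: integrable_on_subinterval)
  define I where "I \<tau> = integral {r..\<tau>} f" for \<tau>
  define \<Phi> where "\<Phi> \<tau> = \<tau> * f \<tau> - I \<tau>" for \<tau>
  have I_incr: "(q - p) * f q \<le> I q - I p" "I q - I p \<le> (q - p) * f p"
    if pq: "r \<le> p" "p < q" "q \<le> t" for p q
  proof -
    have eq: "I q - I p = integral {p..q} f"
      unfolding I_def using Henstock_Kurzweil_Integration.integral_combine[of r p q f] int pq by simp
    show "(q - p) * f q \<le> I q - I p"
      unfolding eq using integral_le[OF integrable_const_ivl int, of p q "f q"] anti pq by simp
    show "I q - I p \<le> (q - p) * f p"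
      unfolding eq using integral_le[OF int integrable_const_ivl, of p q "f p"] anti pq by simp
  qed
  have lower: "\<Phi> p - \<Phi> q - (q - p) * (f p - f q) \<le> norm (u q - u p)"
    if pq: "r \<le> p" "p < q" "q \<le> t" for p q
    using stable[OF pq] I_incr[OF pq] by (simp add: \<Phi>_def algebra_simps)
  have upper: "norm (u q - u p) \<le> \<Phi> p - \<Phi> q + (q - p) * (f p - f q)"
    if pq: "r \<le> p" "p < q" "q \<le> t" for p q
    using dissipation[OF pq] I_incr[OF pq] by (simp add: \<Phi>_def algebra_simps)
  \<comment> \<open>Subdividing \<open>[p,q]\<close> removes the error, so arbitrary partitions can be handled below.\<close>
  have sharp: "norm (u q - u p) \<le> \<Phi> p - \<Phi> q" if pq: "r \<le> p" "p \<le> q" "q \<le> t" for p q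
  proof -
    have "norm (u q - u p) + \<Phi> q \<le> norm (u p - u p) + \<Phi> p"
    proof (rule le_if_fine_increments_small[of p q "\<lambda>x. norm (u x - u p) + \<Phi> x" "\<lambda>x. - f x"])
      fix \<epsilon> :: real assume \<epsilon>: "0 < \<epsilon>"
      have "(norm (u y - u p) + \<Phi> y) - (norm (u x - u p) + \<Phi> x) \<le> \<epsilon> * (- f y - - f x)"
        if xy: "p \<le> x" "x < y" "y \<le> q" "y - x \<le> \<epsilon>" for x y
      proof -
        have "norm (u y - u p) \<le> norm (u y - u x) + norm (u x - u p)"
          using norm_triangle_ineq[of "u y - u x" "u x - u p"] by simp
        moreover have "norm (u y - u x) \<le> \<Phi> x - \<Phi> y + (y - x) * (f x - f y)"
          using xy pq by (intro upper) auto
        moreover have "(y - x) * (f x - f y) \<le> \<epsilon> * (f x - f y)"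
          using anti[of x y] xy pq by (intro mult_right_mono) auto
        ultimately show ?thesis by simp
      qed
      then show "\<exists>\<delta>>0. \<forall>x y. p \<le> x \<and> x < y \<and> y \<le> q \<and> y - x \<le> \<delta> \<longrightarrow>
          (norm (u y - u p) + \<Phi> y) - (norm (u x - u p) + \<Phi> x) \<le> \<epsilon> * (- f y - - f x)"
        using \<epsilon> by (intro exI[of _ \<epsilon>]) auto
    qed (rule pq)
    then show ?thesis by simp
  qed
  have \<Phi>_anti: "\<Phi> q \<le> \<Phi> p" if "r \<le> p" "p \<le> q" "q \<le> t" for p q
    using sharp[OF that] norm_ge_zero[of "u q - u p"] by linarith
  have "variation u r t \<le> ennreal (\<Phi> r - \<Phi> t)"
    unfolding variation_def
  proof (rule Sup_least, safe)
    fix N :: nat and \<tau> :: "nat \<Rightarrow> real"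
    assume \<tau>: "r \<le> \<tau> 0" "strict_mono_on {0..N} \<tau>" "\<tau> N \<le> t"
    have mono: "\<tau> i \<le> \<tau> j" if "i \<le> j" "j \<le> N" for i j
      using strict_mono_on_leD[OF \<tau>(2), of i j] that by simp
    have "(\<Sum>j = 1..N. norm (u (\<tau> j) - u (\<tau> (j - 1)))) \<le> (\<Sum>j = 1..N. \<Phi> (\<tau> (j - 1)) - \<Phi> (\<tau> j))"
    proof (rule sum_mono)
      fix j assume j: "j \<in> {1..N}"
      then have "j - 1 \<le> N" by auto
      with j show "norm (u (\<tau> j) - u (\<tau> (j - 1))) \<le> \<Phi> (\<tau> (j - 1)) - \<Phi> (\<tau> j)"
        using mono[of 0 "j - 1"] mono[of "j - 1" j] mono[of j N] \<tau>(1,3) by (intro sharp) auto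
    qed
    also have "\<dots> = \<Phi> (\<tau> 0) - \<Phi> (\<tau> N)" by (induction N) auto
    also have "\<dots> \<le> \<Phi> r - \<Phi> t"
      using \<Phi>_anti[of r "\<tau> 0"] \<Phi>_anti[of "\<tau> N" t] mono[of 0 N] \<tau> by auto
    finally show "ennreal (\<Sum>j = 1..N. norm (u (\<tau> j) - u (\<tau> (j - 1)))) \<le> ennreal (\<Phi> r - \<Phi> t)"
      by (rule ennreal_leI)
  qed
  moreover have "ennreal (\<Phi> r - \<Phi> t) \<le> variation u r t"
  proof (rule ennreal_le_epsilon)
    fix e :: real assume e: "0 < e"
    obtain n :: nat where n: "(t - r) * (f r - f t) / e < n" using reals_Archimedean2 by blast
    \<comment> \<open>The number of intervals; the successor keeps it positive.\<close>
    define N where "N = Suc n"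
    define d where "d = (t - r) / N"
    define \<tau> where "\<tau> j = r + real j * d" for j
    have d: "0 < d" "\<tau> N = t" using rt by (simp_all add: d_def \<tau>_def N_def)
    have step: "\<tau> j - \<tau> (j - 1) = d" if "j \<in> {1..N}" for j
      using that by (simp add: \<tau>_def of_nat_diff algebra_simps)
    have "d * (f r - f t) \<le> e"
    proof -
      have "(t - r) * (f r - f t) < e * real n" using n e by (simp add: divide_less_eq mult.commute)
      also have "\<dots> \<le> e * real N" using e by (simp add: N_def)
      finally show ?thesis by (simp add: d_def N_def divide_le_eq)
    qed
    have mono: "strict_mono_on {0..N} \<tau>" using d(1) by (auto simp: strict_mono_on_def \<tau>_def)
    have range: "r \<le> \<tau> j" "j \<le> N \<Longrightarrow> \<tau> j \<le> t" for j
    proof -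
      show "r \<le> \<tau> j" using d(1) by (simp add: \<tau>_def)
      show "\<tau> j \<le> t" if "j \<le> N"
        using strict_mono_on_leD[OF mono, of j N] that d(2) by simp
    qed
    have telescope: "(\<Sum>j = 1..n. g (j - 1) - g j) = g 0 - g n" for n and g :: "nat \<Rightarrow> real"
      by (induction n) auto
    have "\<Phi> r - \<Phi> t - d * (f r - f t)
        = (\<Sum>j = 1..N. (\<Phi> (\<tau> (j - 1)) - d * f (\<tau> (j - 1))) - (\<Phi> (\<tau> j) - d * f (\<tau> j)))"
      using telescope[of "\<lambda>j. \<Phi> (\<tau> j) - d * f (\<tau> j)" N] d(2) by (simp add: \<tau>_def algebra_simps)
    also have "\<dots> \<le> (\<Sum>j = 1..N. norm (u (\<tau> j) - u (\<tau> (j - 1))))"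
    proof (rule sum_mono)
      fix j assume j: "j \<in> {1..N}"
      have "\<Phi> (\<tau> (j - 1)) - \<Phi> (\<tau> j) - (\<tau> j - \<tau> (j - 1)) * (f (\<tau> (j - 1)) - f (\<tau> j))
          \<le> norm (u (\<tau> j) - u (\<tau> (j - 1)))"
        using range[of "j - 1"] range[of j] step[OF j] d(1) j by (intro lower) auto
      then show "(\<Phi> (\<tau> (j - 1)) - d * f (\<tau> (j - 1))) - (\<Phi> (\<tau> j) - d * f (\<tau> j))
          \<le> norm (u (\<tau> j) - u (\<tau> (j - 1)))"
        unfolding step[OF j] by (simp add: algebra_simps)
    qed
    finally have "\<Phi> r - \<Phi> t \<le> (\<Sum>j = 1..N. norm (u (\<tau> j) - u (\<tau> (j - 1)))) + e"
      using \<open>d * (f r - f t) \<le> e\<close> by linarith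
    then have "ennreal (\<Phi> r - \<Phi> t)
        \<le> ennreal (\<Sum>j = 1..N. norm (u (\<tau> j) - u (\<tau> (j - 1)))) + ennreal e"
      using e by (subst ennreal_plus[symmetric]) (auto intro: ennreal_leI sum_nonneg)
    also have "\<dots> \<le> variation u r t + ennreal e"
      using range d(2) by (intro add_right_mono variation_ge_increments mono) auto
    finally show "ennreal (\<Phi> r - \<Phi> t) \<le> variation u r t + ennreal e" .
  qed
  ultimately have "variation u r t = ennreal (\<Phi> r - \<Phi> t)" by (rule antisym)
  moreover have "(\<integral>\<^sup>+ \<tau>. ennreal (f \<tau>) \<partial>lebesgue_on {r..t}) = ennreal (I t)"
  proof -
    have "(\<integral>\<^sup>+ \<tau>. ennreal (f \<tau>) \<partial>lebesgue_on {r..t}) = ennreal (integral\<^sup>L (lebesgue_on {r..t}) f)"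
      by (rule nn_integral_eq_integral[OF integrable]) (auto intro!: AE_I2 f0)
    then show ?thesis by (simp add: lebesgue_integral_eq_integral[OF integrable] I_def)
  qed
  moreover have "0 \<le> I t" using I_incr(1)[of r t] f0[of t] rt
    by (simp add: I_def) (smt (verit) mult_nonneg_nonneg)
  moreover have "0 \<le> \<Phi> r - \<Phi> t" "I r = 0" using \<Phi>_anti[of r t] rt by (auto simp: I_def)
  ultimately show ?thesis
    using rt f0[of r] f0[of t] 
    by (simp add: \<Phi>_def ennreal_mult'[symmetric] ennreal_plus[symmetric] del: ennreal_plus)
qed

section \<open>The reparametrised gradient curve\<close>

theorem theorem5p2:
  fixes J :: "'a::{real_inner,complete_space} \<Rightarrow> ennreal"
    and w u :: "real \<Rightarrow> 'a"
    and S :: "real \<Rightarrow> real"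
  assumes "convex_functional J"
    and "lower_semicontinuous J"
    and "positively_homogeneous J"
    and "closure {v. J v < \<infinity>} = UNIV"
    and "gradient_solution J w"
    and "J (w 0) < \<infinity>"
    and "S 0 = 0"
    and "\<And>t. 0 < t \<Longrightarrow> S t = (LEAST s. 0 \<le> s \<and> right_speed w s \<le> ennreal (1 / t))"
    and "\<And>t. 0 \<le> t \<Longrightarrow> u t = w (S t)"
  shows "energetic_solution J u"
proof -
  interpret evi_curve J w
  proof
    show "continuous_on {0..} w" using assms(5) by (simp add: gradient_solution_def)
    show "J (w s) < \<infinity>" if "0 \<le> s" for s
      using gradient_solution_finite_energy[OF assms(2,5), of s] assms(6) that by (cases "s = 0") auto
  qed (use gradient_solution_evi[OF assms(2,5)] gradient_solution_contraction[OF assms(5)] assms(2) in auto)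
  have S: "0 \<le> S t" "(1 / t)-lipschitz_on {S t..} w"
    "\<And>s. 0 \<le> s \<Longrightarrow> (1 / t)-lipschitz_on {s..} w \<Longrightarrow> S t \<le> s" if t: "0 < t" for t
  proof -
    have t': "0 < 1 / t" using t by simp
    obtain m where m: "0 \<le> m" "(1 / t)-lipschitz_on {m..} w"
      "\<And>s. 0 \<le> s \<Longrightarrow> (1 / t)-lipschitz_on {s..} w \<Longrightarrow> m \<le> s"
      by (rule first_lipschitz_time[OF t']) blast
    have "S t = m"
      unfolding assms(8)[OF t]
      using m t' right_speed_le_iff[of _ "1 / t"] by (intro Least_equality) auto
    then show "0 \<le> S t" "(1 / t)-lipschitz_on {S t..} w"
      "\<And>s. 0 \<le> s \<Longrightarrow> (1 / t)-lipschitz_on {s..} w \<Longrightarrow> S t \<le> s"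
      using m by auto
  qed
  have S_nonneg: "0 \<le> S t" if "0 \<le> t" for t
    using S(1)[of t] assms(7) that by (cases "t = 0") auto
  have S_mono: "S p \<le> S q" if pq: "0 \<le> p" "p \<le> q" for p q
  proof (cases "p = 0")
    case True
    then show ?thesis using S_nonneg[of q] assms(7) pq by simp
  next
    case False
    then have "1 / q \<le> 1 / p" "0 < q" using pq by (auto intro: frac_le)
    then have "(1 / p)-lipschitz_on {S q..} w" using lipschitz_on_le[OF S(2)] by blast
    then show ?thesis using S(3)[of p "S q"] S_nonneg[of q] False pq by auto
  qed
  define f where "f t = energy (S t)" for t
  have J_u: "J (u t) = ennreal (f t)" if "0 \<le> t" for t
    using assms(9)[OF that] J_eq_energy[OF S_nonneg[OF that]] by (simp add: f_def)
  have f_nonneg: "0 \<le> f t" for t by (simp add: f_def energy_nonneg)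
  have f_anti: "f q \<le> f p" if "0 \<le> p" "p \<le> q" for p q
    unfolding f_def using that by (intro energy_antimono S_nonneg S_mono)
  have stable: "t * f t \<le> t * enn2real (J v) + norm (v - u t)" if t: "0 \<le> t" and v: "J v < \<infinity>" for t v
  proof (cases "t = 0")
    case False
    then have "f t \<le> enn2real (J v) + 1 / t * norm (v - u t)"
      using energy_stable[OF S(1,2) v, of t] t assms(9)[OF t] by (simp add: f_def)
    from mult_left_mono[OF this t] show ?thesis using False by (simp add: distrib_left)
  qed simp
  have dissipation: "norm (u q - u p) \<le> q * (f p - f q)" if pq: "0 \<le> p" "p < q" for p q
  proof -
    have "energy (S q) + 1 / q * norm (w (S q) - w (S p)) \<le> energy (S p)"
    proof (rule energy_dissipation)
      show "\<not> (1 / q)-lipschitz_on {s..} w" if "S p < s" "s < S q" for s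
        using S(3)[of q s] that S_nonneg[of p] pq by auto
    qed (use pq S_nonneg S_mono in auto)
    then have "norm (u q - u p) / q \<le> f p - f q"
      using pq assms(9) by (simp add: f_def)
    then show ?thesis using pq by (simp add: divide_le_eq mult.commute)
  qed
  have balance: "ennreal t * J (u t) + variation u r t
      = ennreal r * J (u r) + (\<integral>\<^sup>+ \<tau>. J (u \<tau>) \<partial>lebesgue_on {r..t})"
    if rt: "0 \<le> r" "r < t" for r t
  proof -
    have "(\<integral>\<^sup>+ \<tau>. J (u \<tau>) \<partial>lebesgue_on {r..t}) = (\<integral>\<^sup>+ \<tau>. ennreal (f \<tau>) \<partial>lebesgue_on {r..t})"
      using rt by (intro nn_integral_cong) (auto simp: J_u)
    moreover have "p * (f p - f q) \<le> norm (u q - u p)" if "r \<le> p" "p < q" for p q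
      using stable[of p "u q"] that rt J_u[of q] f_nonneg[of q] by (simp add: right_diff_distrib)
    ultimately show ?thesis
      using energy_balance[of r t f u] rt f_nonneg f_anti dissipation by (simp add: J_u)
  qed
  show ?thesis
    unfolding energetic_solution_def
  proof (intro conjI allI impI)
    fix T :: real assume T: "0 < T"
    have "mono_on {0..T} (\<lambda>t. - f t)" by (auto simp: mono_on_def intro: f_anti)
    from integrable_mono_on[OF this] have integrable: "integrable (lebesgue_on {0..T}) f" by simp
    then have "(\<lambda>t. ennreal (f t)) \<in> borel_measurable (lebesgue_on {0..T})" by measurable
    then show "(\<lambda>t. J (u t)) \<in> borel_measurable (lebesgue_on {0..T})"
      by (rule measurable_cong[THEN iffD1, rotated]) (simp add: J_u)
    have "(\<integral>\<^sup>+ t. J (u t) \<partial>lebesgue_on {0..T}) = (\<integral>\<^sup>+ t. ennreal (f t) \<partial>lebesgue_on {0..T})"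
      by (intro nn_integral_cong) (auto simp: J_u)
    also have "\<dots> = ennreal (integral\<^sup>L (lebesgue_on {0..T}) f)"
      by (rule nn_integral_eq_integral[OF integrable]) (simp add: f_nonneg)
    finally show "(\<integral>\<^sup>+ t. J (u t) \<partial>lebesgue_on {0..T}) < \<infinity>" by simp
  next
    fix t :: real and v assume t: "0 \<le> t"
    show "ennreal t * J (u t) \<le> ennreal t * J v + ennreal (norm (v - u t))"
    proof (cases "t = 0")
      case False
      show ?thesis
      proof (cases "J v = \<infinity>")
        case True
        then show ?thesis using False t by (simp add: ennreal_mult_top)
      next
        case Jv: False
        then obtain x where x: "J v = ennreal x" "0 \<le> x" by (cases "J v") auto
        then show ?thesis
          using stable[OF t, of v] t J_u[OF t] f_nonneg[of t]
          by (simp add: ennreal_mult'[symmetric] ennreal_plus[symmetric] ennreal_leI del: ennreal_plus)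
      qed
    qed simp
  next
    show "(u \<longlongrightarrow> u 0) (at_right 0)"
    proof (rule tendsto_eq_rhs[OF Lim_transform_eventually])
      have "(S \<longlongrightarrow> 0) (at_right 0)"
      proof (rule order_tendstoI)
        fix a :: real assume "a < 0"
        then have "a < S t" if "0 < t" for t using S(1)[OF that] by linarith
        then show "\<forall>\<^sub>F t in at_right 0. a < S t" by (auto simp: eventually_at_filter)
      next
        fix a :: real assume a: "0 < a"
        obtain c where c: "c-lipschitz_on {a / 2..} w" using ex_lipschitz_constant[of "a / 2"] a by auto
        have c0: "0 \<le> c" using c by (rule lipschitz_on_nonneg)
        have "S t < a" if t: "0 < t" "t < 1 / (c + 1)" for t
        proof -
          have "c \<le> 1 / t" using t c0 by (simp add: field_simps) 
          then have "S t \<le> a / 2" using S(3)[OF t(1), of "a / 2"] c a lipschitz_on_le by auto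
          then show ?thesis using a by simp
        qed
        moreover have "0 < 1 / (c + 1)" using c0 by simp
        ultimately show "\<forall>\<^sub>F t in at_right 0. S t < a" unfolding eventually_at_right_field by blast
      qed
      moreover have "\<forall>\<^sub>F t in at_right 0. S t \<in> {0..}"
        using S(1) by (auto simp: eventually_at_filter)
      ultimately show "((\<lambda>t. w (S t)) \<longlongrightarrow> w 0) (at_right 0)"
        by (intro continuous_on_tendsto_compose[OF cont]) auto
      show "\<forall>\<^sub>F t in at_right 0. w (S t) = u t"
        using assms(9) by (auto simp: eventually_at_filter)
      show "w 0 = u 0" using assms(7,9) by simp
    qed
  qed (use balance in auto)
qed

end
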